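(* Let $d\ge 1$ be an integer, let $\kappa=\{\kappa_1,\dots,\kappa_d\}$ be a collection of complex numbers, and let $s_0\in\mathbb{C}$ with $0<\Re(s_0)<1$. Then at most one element of the set of complex numbers $$\left\{\frac{L'(f,s_0)}{L(f,s_0)}+\frac{L'(f,1-s_0)}{L(f,1-s_0)} \;\Big|\; f \in E(d,\kappa,N,s_0),\ N \geq 1\right\}$$ is algebraic. Furthermore, if $s_0$ and all $\kappa_j$ are real and satisfy $s_0+\kappa_j\ge 1$ and $1-s_0+\kappa_j\ge 1$ for all $j$, and $N\ge 1$ is an integer with $N^{1/d}>4\pi e^{\gamma}$, then for every $f\in E(d,\kappa,N,s_0)$ we have $$\frac{L'(f,s_0)}{L(f,s_0)}+\frac{L'(f,1-s_0)}{L(f,1-s_0)}\neq 0.$$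
   Context: $\gamma$ is Euler's constant. Let $f$ be a cuspidal automorphic form on $\mathrm{GL}(d)$ (over $\mathbb{Q}$) which is a Hecke eigenform with eigenvalues $\lambda_f(n)$. Its $L$-function is $L(f,s)=\sum_{n\ge 1}\lambda_f(n)n^{-s}$ for $\Re(s)>1$, extended by meromorphic continuation. The completed $L$-function is $$\Lambda(f,s)=N^{s/2}\pi^{-ds/2}\prod_{j=1}^{d}\Gamma\left(\frac{s+\kappa_j}{2}\right)L(f,s),$$ where the integer $N\ge1$ is the conductor and the complex numbers $\kappa_j$ are the local parameters of $f$ at infinity, with $\Re(\kappa_j)>-1$. It continues meromorphically to $\mathbb{C}$ with at most poles at $s=0,1$ and satisfies $\Lambda(f,s)=\epsilon(f)\Lambda(\overline f,1-s)$, where $\overline f$ is the dual of $f$ and $|\epsilon(f)|=1$. The form $f$ is self-dual if $\overline f=f$. $E(d,\kappa,N,s_0)$ denotes the set of all cuspidal, self-dual automorphic Hecke eigenforms $f$ of degree $d$ and conductor $N$ whose local parameters at infinity are $\kappa=\{\kappa_1,\dots,\kappa_d\}$ and for which $L(f,s_0)\ne 0$; it is defined for $\Re(s_0)\in(0,1)$. It is understood that $s_0$ is such that the displayed quantities are defined, i.e. $L(f,1-s_0)\neq 0$ for the forms $f$ considered. *)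

theory Defs
  imports "HOL-Complex_Analysis.Complex_Analysis"
begin

section \<open>Functions on the adelic quotient of level N\<close>

text \<open>
  Let \<open>K\<^sub>1(N)\<close> be the group of all \<open>k\<close> in \<open>GL\<^sub>d(Zhat)\<close> whose last row is congruent to
  \<open>e = (0,\<dots>,0,1)\<close> modulo \<open>N\<close>. As \<open>GL\<^sub>d(A) = GL\<^sub>d(Q) \<cdot> (GL\<^sub>d(R) \<times> GL\<^sub>d(Zhat))\<close>, a function \<open>\<phi>\<close> on
  \<open>GL\<^sub>d(Q) \ GL\<^sub>d(A) / K\<^sub>1(N)\<close> is the same thing as a function of pairs \<open>(g, r)\<close>, where \<open>g\<close> is in
  \<open>GL\<^sub>d(R)\<close> and \<open>r\<close> is a primitive row vector modulo \<open>N\<close>, satisfying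
  \<open>f (\<gamma> g) r = f g (r \<gamma>)\<close> for \<open>\<gamma>\<close> in \<open>GL\<^sub>d(Z)\<close>. The correspondence is
  \<open>f g (e u\<inverse>) = \<phi> (g, u)\<close> for \<open>u\<close> in \<open>GL\<^sub>d(Zhat)\<close>. For \<open>d \<ge> 2\<close> the function \<open>f\<close> is determined by
  the \<open>\<Gamma>\<^sub>1(N)\<close>-invariant function \<open>g \<mapsto> f g e\<close>; the variable \<open>r\<close> is what makes the description
  valid for \<open>d = 1\<close> as well, where these objects are Dirichlet characters.

  The degree \<open>d\<close> is \<open>CARD('n)\<close>. Values of \<open>f\<close> at singular \<open>g\<close> or at imprimitive \<open>r\<close> are
  irrelevant everywhere below.
\<close>

type_synonym 'n level_fun = "real^'n^'n \<Rightarrow> int^'n \<Rightarrow> complex"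

definition primitive_mod :: "nat \<Rightarrow> int^'n \<Rightarrow> bool" where
  "primitive_mod N r \<longleftrightarrow> coprime (int N) (Gcd (range (\<lambda>i. r $ i)))"

definition GL_int :: "(int^'n^'n) set" where
  "GL_int = {\<gamma>. \<bar>det \<gamma>\<bar> = 1}"

abbreviation real_matrix :: "int^'n^'n \<Rightarrow> real^'n^'n" where
  "real_matrix \<equiv> map_matrix real_of_int"

definition level_invariant :: "nat \<Rightarrow> ('n::finite) level_fun \<Rightarrow> bool" where
  "level_invariant N f \<longleftrightarrow>
     (\<forall>g r. \<forall>\<gamma>\<in>GL_int. invertible g \<and> primitive_mod N r \<longrightarrow>
        f (real_matrix \<gamma> ** g) r = f g (r v* \<gamma>)) \<and>
     (\<forall>g r r'. invertible g \<and> primitive_mod N r \<and> (\<forall>i. int N dvd r $ i - r' $ i) \<longrightarrow>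
        f g r = f g r')"


section \<open>Conditions at the archimedean place\<close>

definition unit_matrix :: "'n \<Rightarrow> 'n \<Rightarrow> real^'n^'n" where
  "unit_matrix i j = (\<chi> a b. if a = i \<and> b = j then 1 else 0)"

text \<open>The left invariant vector field attached to the matrix unit \<open>E\<^sub>i\<^sub>j\<close> of the Lie algebra;
  \<open>1 + t E\<^sub>i\<^sub>j\<close> agrees with \<open>exp (t E\<^sub>i\<^sub>j)\<close> to first order at \<open>t = 0\<close>.\<close>

definition lie_deriv :: "'n \<Rightarrow> 'n \<Rightarrow> (real^'n^'n \<Rightarrow> complex) \<Rightarrow> real^('n::finite)^'n \<Rightarrow> complex" where
  "lie_deriv i j h g = vector_derivative (\<lambda>t. h (g ** (mat 1 + t *\<^sub>R unit_matrix i j))) (at 0)"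

inductive_set iterated_lie_derivs ::
  "(real^('n::finite)^'n \<Rightarrow> complex) \<Rightarrow> (real^'n^'n \<Rightarrow> complex) set"
  for h :: "real^'n^'n \<Rightarrow> complex" where
  "h \<in> iterated_lie_derivs h"
| "h' \<in> iterated_lie_derivs h \<Longrightarrow> lie_deriv i j h' \<in> iterated_lie_derivs h"

definition smooth_on_GL :: "(real^('n::finite)^'n \<Rightarrow> complex) \<Rightarrow> bool" where
  "smooth_on_GL h \<longleftrightarrow> (\<forall>h'\<in>iterated_lie_derivs h. h' differentiable_on {g. invertible g})"

text \<open>\<open>lie_power k i j\<close> is the \<open>(i,j)\<close> entry of the \<open>k\<close>-th power of the matrix of operators
  \<open>E\<^sub>i\<^sub>j\<close>. The traces \<open>gelfand_invariant k\<close> generate the centre of the universal enveloping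
  algebra of \<open>gl\<^sub>d\<close>.\<close>

fun lie_power :: "nat \<Rightarrow> 'n \<Rightarrow> 'n \<Rightarrow> (real^('n::finite)^'n \<Rightarrow> complex) \<Rightarrow> real^'n^'n \<Rightarrow> complex" where
  "lie_power 0 i j h = (if i = j then h else (\<lambda>_. 0))"
| "lie_power (Suc k) i j h = (\<lambda>g. \<Sum>l\<in>UNIV. lie_deriv i l (lie_power k l j h) g)"

definition gelfand_invariant ::
  "nat \<Rightarrow> (real^('n::finite)^'n \<Rightarrow> complex) \<Rightarrow> real^'n^'n \<Rightarrow> complex" where
  "gelfand_invariant k h = (\<lambda>g. \<Sum>i\<in>UNIV. lie_power k i i h g)"

inductive_set centre_orbit ::
  "(real^('n::finite)^'n \<Rightarrow> complex) \<Rightarrow> (real^'n^'n \<Rightarrow> complex) set"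
  for h :: "real^'n^'n \<Rightarrow> complex" where
  "h \<in> centre_orbit h"
| "h' \<in> centre_orbit h \<Longrightarrow> gelfand_invariant k h' \<in> centre_orbit h"

definition finite_dim_on_GL :: "(real^('n::finite)^'n \<Rightarrow> complex) set \<Rightarrow> bool" where
  "finite_dim_on_GL H \<longleftrightarrow>
     (\<exists>B. finite B \<and> (\<forall>h\<in>H. \<exists>c. \<forall>g. invertible g \<longrightarrow> h g = (\<Sum>b\<in>B. c b * b g)))"

definition K_finite :: "(real^('n::finite)^'n \<Rightarrow> complex) \<Rightarrow> bool" where
  "K_finite h \<longleftrightarrow> finite_dim_on_GL {(\<lambda>g. h (g ** k)) |k. orthogonal_matrix k}"

definition Z_finite :: "(real^('n::finite)^'n \<Rightarrow> complex) \<Rightarrow> bool" where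
  "Z_finite h \<longleftrightarrow> finite_dim_on_GL (centre_orbit h)"

definition moderate_growth :: "(real^('n::finite)^'n \<Rightarrow> complex) \<Rightarrow> bool" where
  "moderate_growth h \<longleftrightarrow>
     (\<exists>(C::real) (m::nat). \<forall>g. invertible g \<longrightarrow> norm (h g) \<le> C * (norm g + 1 / \<bar>det g\<bar>) ^ m)"


section \<open>Cusp forms\<close>

text \<open>The unipotent radicals used here are \<open>U\<^sub>S = {1 + X. X $ i $ j = 0 unless i \<in> S, j \<notin> S}\<close>; up to
  \<open>GL\<^sub>d(Q)\<close>-conjugacy these are the unipotent radicals of all maximal parabolic subgroups. The
  adelic constant term along \<open>U\<^sub>S\<close> becomes the integral over \<open>U\<^sub>S(NZ) \ U\<^sub>S(R)\<close>, because
  \<open>f (\<gamma> g) r = f g r\<close> for \<open>\<gamma>\<close> in \<open>U\<^sub>S(NZ)\<close>. Coordinates of \<open>X\<close> outside \<open>S \<times> -S\<close> are integrated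
  trivially over a unit interval.\<close>

definition radical_part :: "'n set \<Rightarrow> real^'n^'n \<Rightarrow> real^'n^'n" where
  "radical_part S X = (\<chi> i j. if i \<in> S \<and> j \<notin> S then X $ i $ j else 0)"

definition constant_term ::
  "nat \<Rightarrow> 'n set \<Rightarrow> (real^('n::finite)^'n \<Rightarrow> complex) \<Rightarrow> real^'n^'n \<Rightarrow> complex" where
  "constant_term N S h g =
     integral (cbox 0 (\<chi> i j. 1)) (\<lambda>X. h ((mat 1 + real N *\<^sub>R radical_part S X) ** g))"

definition cuspidal :: "nat \<Rightarrow> ('n::finite) level_fun \<Rightarrow> bool" where
  "cuspidal N f \<longleftrightarrow>
     (\<forall>S g r. S \<noteq> {} \<and> S \<noteq> UNIV \<and> invertible g \<and> primitive_mod N r \<longrightarrow>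
        constant_term N S (\<lambda>g. f g r) g = 0)"

definition unitary_centre :: "nat \<Rightarrow> ('n::finite) level_fun \<Rightarrow> bool" where
  "unitary_centre N f \<longleftrightarrow>
     (\<exists>t::real. \<forall>a::real. \<forall>g r. a > 0 \<and> invertible g \<and> primitive_mod N r \<longrightarrow>
        f (a *\<^sub>R g) r = complex_of_real a powr (\<i> * of_real t) * f g r)"

definition cusp_form :: "nat \<Rightarrow> ('n::finite) level_fun \<Rightarrow> bool" where
  "cusp_form N f \<longleftrightarrow>
     N \<ge> 1 \<and> level_invariant N f \<and>
     (\<exists>g r. invertible g \<and> primitive_mod N r \<and> f g r \<noteq> 0) \<and>
     (\<forall>r. primitive_mod N r \<longrightarrow>
        smooth_on_GL (\<lambda>g. f g r) \<and> K_finite (\<lambda>g. f g r) \<and>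
        Z_finite (\<lambda>g. f g r) \<and> moderate_growth (\<lambda>g. f g r)) \<and>
     unitary_centre N f \<and> cuspidal N f"


section \<open>Hecke operators, newforms and duality\<close>

text \<open>
  The operator \<open>T\<^sub>n\<close> is \<open>n powr (-(d-1)/2)\<close> times the sum of \<open>\<phi> (g m)\<close> over the cosets
  \<open>m K\<^sub>1(N)\<close> of finite adelic matrices \<open>m\<close> that are integral, have determinant of norm \<open>1/n\<close>, and
  have last row congruent to \<open>e\<close> modulo \<open>N\<close>. In terms of \<open>f\<close> these cosets are the
  \<open>\<delta> GL\<^sub>d(Z)\<close> with \<open>\<delta>\<close> integral of determinant \<open>n\<close> or \<open>-n\<close> and \<open>r \<delta>\<close> primitive modulo \<open>N\<close>.
  By invariance the summand depends on the coset only, so any representative may be chosen.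
  With this normalisation the eigenvalues on a newform are the Dirichlet coefficients of its
  standard L-function at all \<open>n\<close>, including those not coprime to \<open>N\<close>.
\<close>

definition integral_cosets :: "nat \<Rightarrow> (int^('n::finite)^'n) set set" where
  "integral_cosets n = (\<lambda>\<delta>. (\<lambda>\<gamma>. \<delta> ** \<gamma>) ` GL_int) ` {\<delta>. \<bar>det \<delta>\<bar> = int n}"

definition hecke_op :: "nat \<Rightarrow> nat \<Rightarrow> ('n::finite) level_fun \<Rightarrow> 'n level_fun" where
  "hecke_op N n f g r =
     of_real (real n powr (- (real CARD('n) - 1) / 2)) *
     (\<Sum>C\<in>integral_cosets n.
        let \<delta> = (SOME \<delta>. \<delta> \<in> C)
        in if primitive_mod N (r v* \<delta>) then f (matrix_inv (real_matrix \<delta>) ** g) (r v* \<delta>) else 0)"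

definition has_hecke_eigenvalue :: "nat \<Rightarrow> ('n::finite) level_fun \<Rightarrow> nat \<Rightarrow> complex \<Rightarrow> bool" where
  "has_hecke_eigenvalue N f n c \<longleftrightarrow>
     (\<forall>g r. invertible g \<and> primitive_mod N r \<longrightarrow> hecke_op N n f g r = c * f g r)"

definition hecke_eigenform :: "nat \<Rightarrow> ('n::finite) level_fun \<Rightarrow> bool" where
  "hecke_eigenform N f \<longleftrightarrow> cusp_form N f \<and> (\<forall>n\<ge>1. \<exists>c. has_hecke_eigenvalue N f n c)"

definition hecke_eigenvalue :: "nat \<Rightarrow> ('n::finite) level_fun \<Rightarrow> nat \<Rightarrow> complex" where
  "hecke_eigenvalue N f n = (THE c. has_hecke_eigenvalue N f n c)"

text \<open>The conductor is the least level at which the system of Hecke eigenvalues away from the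
  level occurs; \<open>newform N f\<close> says that the eigenform \<open>f\<close> lives at the level of its conductor
  and that this is \<open>N\<close>.\<close>

definition newform :: "nat \<Rightarrow> ('n::finite) level_fun \<Rightarrow> bool" where
  "newform N f \<longleftrightarrow> hecke_eigenform N f \<and>
     (\<forall>M. \<forall>f' :: 'n level_fun. hecke_eigenform M f' \<and>
        (\<forall>n\<ge>1. coprime n (M * N) \<longrightarrow> hecke_eigenvalue M f' n = hecke_eigenvalue N f n) \<longrightarrow> N \<le> M)"

definition dual_form :: "'n level_fun \<Rightarrow> 'n level_fun" where
  "dual_form f = (\<lambda>g r. cnj (f g r))"

text \<open>Eigenforms are identified when they generate the same automorphic representation, i.e.
  when they have the same Hecke eigenvalues. Pointwise equality of \<open>f\<close> with its complex conjugate
  would be too strong: for a holomorphic form on \<open>GL\<^sub>2\<close> the two are different vectors of the same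
  representation.\<close>

definition self_dual :: "nat \<Rightarrow> ('n::finite) level_fun \<Rightarrow> bool" where
  "self_dual N f \<longleftrightarrow> (\<forall>n\<ge>1. hecke_eigenvalue N (dual_form f) n = hecke_eigenvalue N f n)"


section \<open>L-functions\<close>

text \<open>A meromorphic function is normalised to be continuous off its poles and 0 at its poles, so
  the continuation is unique if it exists.\<close>

definition is_L_continuation ::
  "nat \<Rightarrow> ('n::finite) level_fun \<Rightarrow> (complex \<Rightarrow> complex) \<Rightarrow> bool" where
  "is_L_continuation N f F \<longleftrightarrow> F nicely_meromorphic_on UNIV \<and>
     (\<forall>s. Re s > 1 \<longrightarrow>
        (\<lambda>n. hecke_eigenvalue N f (Suc n) * of_nat (Suc n) powr (- s)) sums F s)"

definition L_function :: "nat \<Rightarrow> ('n::finite) level_fun \<Rightarrow> complex \<Rightarrow> complex" where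
  "L_function N f = (SOME F. is_L_continuation N f F)"

definition gamma_product :: "('n::finite \<Rightarrow> complex) \<Rightarrow> complex \<Rightarrow> complex" where
  "gamma_product \<kappa> s =
     of_real pi powr (- of_nat CARD('n) * s / 2) * (\<Prod>j\<in>UNIV. Gamma ((s + \<kappa> j) / 2))"

text \<open>The removable singularities come from poles of the Gamma factors at zeros of
  \<open>L_function N f\<close>.\<close>

definition completed_L :: "nat \<Rightarrow> ('n::finite \<Rightarrow> complex) \<Rightarrow> 'n level_fun \<Rightarrow> complex \<Rightarrow> complex" where
  "completed_L N \<kappa> f =
     remove_sings (\<lambda>s. of_nat N powr (s / 2) * gamma_product \<kappa> s * L_function N f s)"

text \<open>
  The local parameters at infinity are those of the archimedean L-factor in the sense of
  Godement and Jacquet: \<open>gamma_product \<kappa>\<close> is the greatest common divisor of the local zeta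
  integrals of \<open>\<Phi> x * f (g x) r * \<bar>det x\<bar> powr (s + (d-1)/2)\<close> against the Haar measure
  \<open>dx / \<bar>det x\<bar> powr d\<close> of \<open>GL\<^sub>d(R)\<close>, where \<open>\<Phi>\<close> runs through the products of a polynomial and the
  Gaussian. That is, every zeta integral is a polynomial in \<open>s\<close> times \<open>gamma_product \<kappa> s\<close>, and
  these polynomials have no common zero. This determines the family \<open>\<kappa>\<close> up to permutation.
\<close>

definition zeta_quotient ::
  "('n::finite) level_fun \<Rightarrow> ('n \<Rightarrow> complex) \<Rightarrow> (real^'n^'n \<Rightarrow> real) \<Rightarrow> real^'n^'n \<Rightarrow> int^'n \<Rightarrow>
   complex poly \<Rightarrow> bool" where
  "zeta_quotient f \<kappa> q g r P \<longleftrightarrow>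
     (\<exists>\<sigma>::real. \<forall>s. Re s > \<sigma> \<longrightarrow>
        has_bochner_integral lborel
          (\<lambda>x. of_real (q x * exp (- pi * (norm x)\<^sup>2)) * f (g ** x) r *
               of_real \<bar>det x\<bar> powr (s + (of_nat CARD('n) - 1) / 2 - of_nat CARD('n)))
          (poly P s * gamma_product \<kappa> s))"

definition local_parameters_at_infinity ::
  "nat \<Rightarrow> ('n::finite) level_fun \<Rightarrow> ('n \<Rightarrow> complex) \<Rightarrow> bool" where
  "local_parameters_at_infinity N f \<kappa> \<longleftrightarrow>
     (\<forall>q g r. real_polynomial_function q \<and> invertible g \<and> primitive_mod N r \<longrightarrow>
        (\<exists>P. zeta_quotient f \<kappa> q g r P)) \<and>
     (\<forall>s. \<exists>q g r P. real_polynomial_function q \<and> invertible g \<and> primitive_mod N r \<and>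
        zeta_quotient f \<kappa> q g r P \<and> poly P s \<noteq> 0)"

text \<open>The standing analytic properties of \<open>L_function N f\<close>. For every newform of conductor \<open>N\<close> with
  local parameters \<open>\<kappa>\<close> they are known (Godement and Jacquet; Jacquet, Piatetski-Shapiro and
  Shalika). The parameters of the dual form are the complex conjugates of those of \<open>f\<close>.\<close>

definition standard_analytic_properties ::
  "nat \<Rightarrow> ('n::finite) level_fun \<Rightarrow> ('n \<Rightarrow> complex) \<Rightarrow> bool" where
  "standard_analytic_properties N f \<kappa> \<longleftrightarrow>
     (\<forall>j. Re (\<kappa> j) > - 1) \<and>
     (\<exists>F. is_L_continuation N f F) \<and>
     completed_L N \<kappa> f meromorphic_on UNIV \<and>
     completed_L N \<kappa> f holomorphic_on - {0, 1} \<and>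
     (\<exists>\<epsilon>. norm \<epsilon> = 1 \<and>
        (\<forall>s. s \<notin> {0, 1} \<longrightarrow>
           completed_L N \<kappa> f s = \<epsilon> * completed_L N (\<lambda>j. cnj (\<kappa> j)) (dual_form f) (1 - s)))"


section \<open>The families of forms\<close>

definition E_forms :: "('n::finite \<Rightarrow> complex) \<Rightarrow> nat \<Rightarrow> complex \<Rightarrow> 'n level_fun set" where
  "E_forms \<kappa> N s0 =
     {f. newform N f \<and> self_dual N f \<and>
         local_parameters_at_infinity N f \<kappa> \<and> standard_analytic_properties N f \<kappa> \<and>
         L_function N f s0 \<noteq> 0}"

definition log_deriv_sum :: "nat \<Rightarrow> ('n::finite) level_fun \<Rightarrow> complex \<Rightarrow> complex" where
  "log_deriv_sum N f s0 =
     deriv (L_function N f) s0 / L_function N f s0 +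
     deriv (L_function N f) (1 - s0) / L_function N f (1 - s0)"

end

theory Submission
  imports Defs "Jordan_Normal_Form.Determinant"
begin

text \<open>
  The logarithmic derivative of the functional equation at \<open>s\<^sub>0\<close> shows that the sum in question is
  \<open>C - ln N\<close>, where \<open>C\<close> depends on \<open>\<kappa>\<close> and \<open>s\<^sub>0\<close> only. Two different algebraic values would make
  \<open>\<alpha> = ln (N / M)\<close> algebraic for some \<open>N > M\<close>. Then all values \<open>exp (k \<alpha>)\<close> are rational, and
  Hermite's approximations \<open>\<Sum>\<^sub>k A\<^sub>k(x) exp (k x)\<close>, which vanish to high order at \<open>0\<close>, give at
  \<open>x = \<alpha>\<close> integer polynomials in \<open>\<alpha>\<close> that are positive but smaller than Liouville's lower bound as
  soon as the number of exponentials exceeds the degree of \<open>\<alpha>\<close>. For the nonvanishing, the digamma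
  function is at least \<open>-\<gamma> - 2 ln 2\<close> on \<open>[1/2, \<infinity>)\<close>, so the sum is negative once
  \<open>N > (4 \<pi> e\<^sup>\<gamma>)\<^sup>d\<close>.
\<close>


section \<open>The functional equation\<close>

text \<open>Up to the power of \<pi> this is the reciprocal of \<open>gamma_product\<close>. It is
  entire: poles of the Gamma factors become zeros.\<close>

definition rGamma_prod :: "('n::finite \<Rightarrow> complex) \<Rightarrow> complex \<Rightarrow> complex" where
  "rGamma_prod \<kappa> s = (\<Prod>j\<in>UNIV. rGamma ((s + \<kappa> j) / 2))"

lemma analytic_rGamma_prod: "rGamma_prod \<kappa> analytic_on A"
  unfolding rGamma_prod_def [abs_def]
  by (intro analytic_on_prod analytic_intros analytic_rGamma) auto

text \<open>As \<open>rGamma\<close> vanishes only at the nonpositive integers, distinct zeros of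
  this function of \<open>s\<close> are at distance at least 2, so the punctured unit disc around a
  zero contains no other.\<close>

lemma eventually_rGamma_nonzero: "\<forall>\<^sub>F s in at w. rGamma ((s + a) / 2) \<noteq> (0::complex)"
proof (cases "(w + a) / 2 \<in> \<int>\<^sub>\<le>\<^sub>0")
  case False
  have "((\<lambda>s. (s + a) / 2) \<longlongrightarrow> (w + a) / 2) (at w)"
    by (intro tendsto_intros) auto
  moreover have "open (- \<int>\<^sub>\<le>\<^sub>0 :: complex set)"
    by (simp add: open_Compl)
  ultimately have "\<forall>\<^sub>F s in at w. (s + a) / 2 \<in> - \<int>\<^sub>\<le>\<^sub>0"
    using False by (intro topological_tendstoD) auto
  then show ?thesis
    by eventually_elim (simp add: rGamma_eq_zero_iff)
next
  case True
  then obtain m where m: "(w + a) / 2 = of_int m"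
    by (auto elim!: nonpos_Ints_cases)
  have "\<forall>\<^sub>F s in at w. s \<in> ball w 1 - {w}"
    by (intro eventually_at_in_open) auto
  then show ?thesis
  proof eventually_elim
    case (elim s)
    show ?case
    proof
      assume "rGamma ((s + a) / 2) = 0"
      then obtain l where l: "(s + a) / 2 = of_int l"
        by (auto simp: rGamma_eq_zero_iff elim!: nonpos_Ints_cases)
      have "s + a = 2 * of_int l" "w + a = 2 * of_int m"
        using l m by (auto simp: field_simps)
      moreover have "s - w = (s + a) - (w + a)" by simp
      ultimately have eq: "s - w = of_int (2 * (l - m))"
        by (simp add: algebra_simps)
      with elim have "l \<noteq> m" by auto
      then have "2 \<le> \<bar>2 * (l - m)\<bar>" by presburger
      then have "real_of_int 2 \<le> real_of_int \<bar>2 * (l - m)\<bar>"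
        by (simp only: of_int_le_iff)
      then have "norm (of_int (2 * (l - m)) :: complex) \<ge> 2"
        by (simp only: norm_of_int of_int_abs of_int_numeral)
      then show False
        using elim eq by (simp add: dist_norm norm_minus_commute)
    qed
  qed
qed

lemma pi_not_nonpos: "\<not> pi \<le> 0"
  by (simp add: not_le)

lemma meromorphic_gamma_product: "gamma_product \<kappa> meromorphic_on A"
proof -
  have "(\<lambda>s. inverse (rGamma ((s + a) / 2))) meromorphic_on A" for a
    by (intro meromorphic_on_inverse analytic_on_imp_meromorphic_on analytic_intros analytic_rGamma) auto
  then have "(\<lambda>s. Gamma ((s + a) / 2)) meromorphic_on A" for a
    by (simp add: Gamma_def)
  then show ?thesis
    unfolding gamma_product_def [abs_def]
    by (intro meromorphic_on_mult meromorphic_on_prod)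
       (auto intro!: analytic_on_imp_meromorphic_on analytic_intros simp: pi_not_nonpos)
qed

lemma gamma_product_times_rGamma_prod:
  fixes \<kappa> :: "'n::finite \<Rightarrow> complex"
  assumes "rGamma_prod \<kappa> s \<noteq> 0"
  shows "gamma_product \<kappa> s * rGamma_prod \<kappa> s = of_real pi powr (- of_nat CARD('n) * s / 2)"
proof -
  have "(\<Prod>j\<in>UNIV. Gamma ((s + \<kappa> j) / 2)) * rGamma_prod \<kappa> s = 1"
    using assms by (simp add: rGamma_prod_def Gamma_def flip: prod.distrib)
  then show ?thesis by (simp add: gamma_product_def mult.assoc)
qed

text \<open>The identity is immediate near \<open>w\<close>, where no Gamma factor has a pole. Both
  sides are continuous at \<open>w\<close>, so it persists there even if a Gamma factor has a pole
  at \<open>w\<close>.\<close>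

lemma completed_L_times_rGamma_prod:
  fixes \<kappa> :: "'n::finite \<Rightarrow> complex"
  assumes "N \<ge> 1" and L: "L_function N f analytic_on {w}" and "isCont (completed_L N \<kappa> f) w"
  shows "completed_L N \<kappa> f w * rGamma_prod \<kappa> w =
    of_nat N powr (w / 2) * of_real pi powr (- of_nat CARD('n) * w / 2) * L_function N f w"
proof -
  let ?g = "\<lambda>s. of_nat N powr (s / 2) * gamma_product \<kappa> s * L_function N f s"
  let ?h = "\<lambda>s. of_nat N powr (s / 2) * of_real pi powr (- of_nat CARD('n) * s / 2) * L_function N f s"
  have "?g meromorphic_on {w}"
    using assms
    by (intro meromorphic_on_mult meromorphic_gamma_product analytic_on_imp_meromorphic_on [OF L]
          analytic_on_imp_meromorphic_on analytic_intros) auto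
  then have "\<forall>\<^sub>F s in at w. completed_L N \<kappa> f s = ?g s"
    unfolding completed_L_def
    by (intro eventually_remove_sings_eq_at) (simp add: meromorphic_at_iff)
  moreover have "\<forall>\<^sub>F s in at w. rGamma_prod \<kappa> s \<noteq> 0"
    using eventually_rGamma_nonzero
    by (auto simp: rGamma_prod_def intro: eventually_ball_finite [of UNIV, simplified])
  ultimately have ev: "\<forall>\<^sub>F s in at w. completed_L N \<kappa> f s * rGamma_prod \<kappa> s = ?h s"
  proof eventually_elim
    case (elim s)
    show ?case
      unfolding elim(1) gamma_product_times_rGamma_prod [OF elim(2), symmetric] by (simp only: mult_ac)
  qed
  have "isCont (\<lambda>s. completed_L N \<kappa> f s * rGamma_prod \<kappa> s) w"
    using assms analytic_at_imp_isCont [OF analytic_rGamma_prod] by (intro continuous_intros)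
  moreover have "isCont ?h w"
    using assms
    by (intro analytic_at_imp_isCont analytic_intros) (auto simp: pi_not_nonpos)
  ultimately show ?thesis
    unfolding isCont_def using tendsto_cong [OF ev] by (blast intro: LIM_unique)
qed

section \<open>The logarithmic derivative for a self-dual form\<close>

text \<open>The continuation depends on the form only through its Hecke eigenvalues, which agree for
  the form and its dual, so \<open>SOME\<close> makes the same choice.\<close>

lemma L_function_dual_form:
  assumes "self_dual N f"
  shows "L_function N (dual_form f) = L_function N f"
  using assms by (simp add: L_function_def is_L_continuation_def self_dual_def)

text \<open>A nicely meromorphic function has the value 0 at its poles, so a nonzero value excludes
  a pole.\<close>

lemma L_function_analytic_at:
  assumes "\<exists>F. is_L_continuation N f F" and "L_function N f z \<noteq> 0"
  shows "L_function N f analytic_on {z}"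
proof -
  have "is_L_continuation N f (L_function N f)"
    unfolding L_function_def using assms(1) by (rule someI_ex)
  then have nice: "L_function N f nicely_meromorphic_on UNIV"
    by (simp add: is_L_continuation_def)
  then have "\<not> is_pole (L_function N f) z"
    using assms(2) unfolding nicely_meromorphic_on_def
    by (metis UNIV_I at_neq_bot is_pole_def not_tendsto_and_filterlim_at_infinity)
  then show ?thesis
    using nice by (intro nicely_meromorphic_on_imp_analytic_at) auto
qed

lemma has_field_derivative_rGamma_prod:
  fixes \<kappa> :: "'n::finite \<Rightarrow> complex"
  assumes "rGamma_prod \<kappa> z \<noteq> 0"
  shows "(rGamma_prod \<kappa> has_field_derivative
           rGamma_prod \<kappa> z * - (\<Sum>j\<in>UNIV. Digamma ((z + \<kappa> j) / 2)) / 2) (at z)"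
proof -
  have nz: "rGamma ((z + \<kappa> j) / 2) \<noteq> 0" for j
    using assms by (auto simp: rGamma_prod_def)
  have "((\<lambda>s. rGamma ((s + \<kappa> j) / 2)) has_field_derivative
      rGamma ((z + \<kappa> j) / 2) * (- Digamma ((z + \<kappa> j) / 2) / 2)) (at z)" for j
    using nz [of j] by (auto intro!: derivative_eq_intros simp: rGamma_eq_zero_iff)
  then have "((\<lambda>s. \<Prod>j\<in>UNIV. rGamma ((s + \<kappa> j) / 2)) has_field_derivative
      (\<Prod>j\<in>UNIV. rGamma ((z + \<kappa> j) / 2)) *
      (\<Sum>j\<in>UNIV. rGamma ((z + \<kappa> j) / 2) * (- Digamma ((z + \<kappa> j) / 2) / 2) / rGamma ((z + \<kappa> j) / 2))) (at z)"
    using nz by (intro has_field_derivative_prod') auto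
  then show ?thesis
    using nz by (simp add: rGamma_prod_def [abs_def] sum_negf flip: sum_divide_distrib)
qed

text \<open>The factor \<open>rGamma_prod\<close> keeps the identity meaningful when a Gamma factor has a pole; a
  nonzero value of \<open>L_function\<close> then shows that it has none at \<open>z\<close>.\<close>

lemma completed_L_log_deriv:
  fixes \<kappa> :: "'n::finite \<Rightarrow> complex"
  assumes "N \<ge> 1" and L: "L_function N f analytic_on {z}" and "L_function N f z \<noteq> 0"
    and hol: "completed_L N \<kappa> f holomorphic_on A" "open A" "z \<in> A"
  shows "completed_L N \<kappa> f z \<noteq> 0"
    and "deriv (completed_L N \<kappa> f) z / completed_L N \<kappa> f z =
      (of_real (ln (real N)) - of_nat CARD('n) * of_real (ln pi)
        + (\<Sum>j\<in>UNIV. Digamma ((z + \<kappa> j) / 2))) / 2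
      + deriv (L_function N f) z / L_function N f z"
proof -
  let ?h = "\<lambda>s. of_nat N powr (s / 2) * of_real pi powr (- of_nat CARD('n) * s / 2) * L_function N f s"
  obtain B where B: "open B" "z \<in> B" "L_function N f holomorphic_on B"
    using L by (auto simp: analytic_at)
  have eq: "completed_L N \<kappa> f w * rGamma_prod \<kappa> w = ?h w" if "w \<in> A \<inter> B" for w
  proof (rule completed_L_times_rGamma_prod)
    show "L_function N f analytic_on {w}"
      using B that by (auto simp: analytic_at)
    show "isCont (completed_L N \<kappa> f) w"
      using hol that continuous_on_eq_continuous_at holomorphic_on_imp_continuous_on by blast
  qed fact
  \<comment> \<open>The right-hand side of the identity at \<open>z\<close> is a product of nonzero
    factors.\<close>
  have "completed_L N \<kappa> f z * rGamma_prod \<kappa> z \<noteq> 0"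
    using assms B eq [of z] by simp
  then have nz: "completed_L N \<kappa> f z \<noteq> 0" and rnz: "rGamma_prod \<kappa> z \<noteq> 0"
    by auto
  show "completed_L N \<kappa> f z \<noteq> 0" by (fact nz)
  let ?C = "completed_L N \<kappa> f" and ?D = "\<Sum>j\<in>UNIV. Digamma ((z + \<kappa> j) / 2)"
  have dC: "(?C has_field_derivative deriv ?C z) (at z)"
    using hol by (intro holomorphic_derivI)
  have dL: "(L_function N f has_field_derivative deriv (L_function N f) z) (at z)"
    using B by (intro holomorphic_derivI)
  have dCr: "((\<lambda>w. ?C w * rGamma_prod \<kappa> w) has_field_derivative
          ?C z * (rGamma_prod \<kappa> z * - ?D / 2) + deriv ?C z * rGamma_prod \<kappa> z) (at z)"
    by (rule DERIV_mult' [OF dC has_field_derivative_rGamma_prod [OF rnz]])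
  have dN: "((\<lambda>s. of_nat N powr (s / 2)) has_field_derivative
      of_real (ln (real N)) * of_nat N powr (z / 2) * (1 / 2)) (at z)"
    using assms(1) has_field_derivative_powr_right [of "of_nat N" "z / 2"]
    by (intro DERIV_chain2 [where g = "\<lambda>s. s / 2"] derivative_eq_intros refl) (auto simp: Ln_of_nat)
  have dp: "((\<lambda>s. of_real pi powr (- of_nat CARD('n) * s / 2)) has_field_derivative
      of_real (ln pi) * of_real pi powr (- of_nat CARD('n) * z / 2) * (- of_nat CARD('n) / 2)) (at z)"
    using has_field_derivative_powr_right [of "of_real pi" "- of_nat CARD('n) * z / 2"]
    by (intro DERIV_chain2 [where g = "\<lambda>s. - of_nat CARD('n) * s / 2"] derivative_eq_intros refl)
       (auto simp: Ln_of_real)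
  have dh: "(?h has_field_derivative
      ?h z * ((of_real (ln (real N)) - of_nat CARD('n) * of_real (ln pi)) / 2
        + deriv (L_function N f) z / L_function N f z)) (at z)"
    by (rule DERIV_cong [OF DERIV_mult' [OF DERIV_mult' [OF dN dp] dL]])
       (use assms(3) in \<open>simp add: field_simps\<close>)
  have ev: "\<forall>\<^sub>F w in nhds z. ?C w * rGamma_prod \<kappa> w = ?h w"
  proof (rule eventually_mono [OF _ eq])
    show "\<forall>\<^sub>F w in nhds z. w \<in> A \<inter> B"
      using hol B by (intro eventually_nhds_in_open) auto
  qed
  have "?C z * (rGamma_prod \<kappa> z * - ?D / 2) + deriv ?C z * rGamma_prod \<kappa> z =
      ?h z * ((of_real (ln (real N)) - of_nat CARD('n) * of_real (ln pi)) / 2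
        + deriv (L_function N f) z / L_function N f z)"
    by (rule DERIV_unique [OF DERIV_cong_ev [THEN iffD1, OF refl ev refl dCr] dh])
  also have "?h z = ?C z * rGamma_prod \<kappa> z"
    using eq hol B by auto
  finally have "?C z * (rGamma_prod \<kappa> z * - ?D / 2) + deriv ?C z * rGamma_prod \<kappa> z = rGamma_prod \<kappa> z * ?C z *
      ((of_real (ln (real N)) - of_nat CARD('n) * of_real (ln pi)) / 2
        + deriv (L_function N f) z / L_function N f z)"
    by (simp only: mult_ac)
  moreover have "rGamma_prod \<kappa> z * ?C z * (deriv ?C z / ?C z - ?D / 2) =
      ?C z * (rGamma_prod \<kappa> z * - ?D / 2) + deriv ?C z * rGamma_prod \<kappa> z"
    using nz by (simp add: field_simps)
  ultimately have "deriv ?C z / ?C z - ?D / 2 = (of_real (ln (real N)) - of_nat CARD('n) * of_real (ln pi)) / 2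
        + deriv (L_function N f) z / L_function N f z"
    using nz rnz by simp
  then show "deriv ?C z / ?C z =
      (of_real (ln (real N)) - of_nat CARD('n) * of_real (ln pi) + ?D) / 2
      + deriv (L_function N f) z / L_function N f z"
    by (simp add: add_divide_distrib diff_divide_distrib algebra_simps)
qed

text \<open>The conjugates are the parameters of the dual form, which stands on the other side of
  the functional equation. Neither the form nor its conductor enters.\<close>

definition log_deriv_const :: "('n::finite \<Rightarrow> complex) \<Rightarrow> complex \<Rightarrow> complex" where
  "log_deriv_const \<kappa> s0 = of_nat CARD('n) * of_real (ln pi)
     - (\<Sum>j\<in>UNIV. Digamma ((s0 + \<kappa> j) / 2) + Digamma ((1 - s0 + cnj (\<kappa> j)) / 2)) / 2"

text \<open>Logarithmic differentiation of the functional equation removes \<epsilon>, and because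
  of the reflection the logarithmic derivatives of the completed functions at \<open>s0\<close> and
  \<open>1 - s0\<close> add up to 0. The conductor contributes \<open>ln N / 2\<close> to
  each.\<close>

lemma log_deriv_sum_eq:
  fixes \<kappa> :: "'n::finite \<Rightarrow> complex"
  assumes s0: "0 < Re s0" "Re s0 < 1" and N: "N \<ge> 1" and f: "f \<in> E_forms \<kappa> N s0"
    and L1: "L_function N f (1 - s0) \<noteq> 0"
  shows "log_deriv_sum N f s0 = log_deriv_const \<kappa> s0 - of_real (ln (real N))"
proof -
  define \<kappa>' where "\<kappa>' = (\<lambda>j. cnj (\<kappa> j))"
  define C where "C = completed_L N \<kappa> f"
  define C' where "C' = completed_L N \<kappa>' f"
  have dual: "L_function N (dual_form f) = L_function N f"
    using f by (intro L_function_dual_form) (simp add: E_forms_def)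
  have L0: "L_function N f s0 \<noteq> 0" and ex: "\<exists>F. is_L_continuation N f F"
    and hol: "C holomorphic_on - {0, 1}"
    using f by (auto simp: E_forms_def standard_analytic_properties_def C_def)
  obtain \<epsilon> where \<epsilon>: "norm \<epsilon> = 1" "\<And>s. s \<notin> {0, 1} \<Longrightarrow> C s = \<epsilon> * C' (1 - s)"
    using f dual
    by (auto simp: E_forms_def standard_analytic_properties_def C_def C'_def \<kappa>'_def completed_L_def)
  then have eps: "\<epsilon> \<noteq> 0" by auto
  have s: "s0 \<in> - {0, 1}" "1 - s0 \<in> - {0, 1}"
    using s0 by auto
  have op: "open (- {0, 1 :: complex})"
    by (intro open_Compl finite_imp_closed) auto
  \<comment> \<open>Holomorphy is given for the parameters \<kappa>; the functional equation
    transfers it to their conjugates.\<close>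
  have "(\<lambda>s. C (1 - s) / \<epsilon>) holomorphic_on - {0, 1}"
    using eps by (intro holomorphic_intros holomorphic_on_compose_gen [OF _ hol, unfolded o_def]) auto
  moreover have "C (1 - s) / \<epsilon> = C' s" if "s \<in> - {0, 1}" for s
    using \<epsilon>(2) [of "1 - s"] that eps by auto
  ultimately have hol': "C' holomorphic_on - {0, 1}"
    by (rule holomorphic_transform)
  note C = completed_L_log_deriv [OF N L_function_analytic_at [OF ex L0] L0 hol [unfolded C_def] op s(1), folded C_def]
  note C' = completed_L_log_deriv [OF N L_function_analytic_at [OF ex L1] L1 hol' [unfolded C'_def] op s(2), folded C'_def]
  have "(C' has_field_derivative deriv C' (1 - s0)) (at (1 - s0))"
    using hol' op s by (intro holomorphic_derivI)
  then have "((\<lambda>s. \<epsilon> * C' (1 - s)) has_field_derivative \<epsilon> * (deriv C' (1 - s0) * (- 1))) (at s0)"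
    by (intro DERIV_cmult DERIV_chain2 [of C' _ "\<lambda>s. 1 - s"]) (auto intro!: derivative_eq_intros)
  moreover have "\<forall>\<^sub>F w in nhds s0. C w = \<epsilon> * C' (1 - w)"
    using eventually_nhds_in_open [OF op s(1)] by (rule eventually_mono) (use \<epsilon> in auto)
  ultimately have "deriv C s0 = - \<epsilon> * deriv C' (1 - s0)"
    by (intro DERIV_imp_deriv) (simp add: DERIV_cong_ev)
  then have z: "deriv C s0 / C s0 + deriv C' (1 - s0) / C' (1 - s0) = 0"
    using \<epsilon>(2) [of s0] s C(1) C'(1) eps by simp
  have add_eq: "x + y = - a / 2 - b / 2" if "a / 2 + x + (b / 2 + y) = 0" for a b x y :: complex
  proof -
    have "x + y = (a / 2 + x + (b / 2 + y)) - a / 2 - b / 2" by simp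
    then show ?thesis unfolding that by simp
  qed
  from z have "deriv (L_function N f) s0 / L_function N f s0 +
      deriv (L_function N f) (1 - s0) / L_function N f (1 - s0) =
     - (of_real (ln (real N)) - of_nat CARD('n) * of_real (ln pi)
       + (\<Sum>j\<in>UNIV. Digamma ((s0 + \<kappa> j) / 2))) / 2
     - (of_real (ln (real N)) - of_nat CARD('n) * of_real (ln pi)
       + (\<Sum>j\<in>UNIV. Digamma ((1 - s0 + \<kappa>' j) / 2))) / 2"
    unfolding C(2) C'(2) by (rule add_eq)
  moreover have "- (n - d + a) / 2 - (n - d + b) / 2 = d - (a + b) / 2 - n" for n d a b :: complex
    by (simp add: field_simps)
  ultimately show ?thesis
    unfolding log_deriv_sum_def log_deriv_const_def \<kappa>'_def sum.distrib by (simp only:)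
qed

section \<open>Size of the digamma terms\<close>

text \<open>The digamma function increases on the positive reals, and the bound is its value at
  \<open>1/2\<close>.\<close>

lemma Digamma_real_ge_at_half:
  assumes "x \<ge> 1/2"
  shows "Digamma (x::real) \<ge> - euler_mascheroni - 2 * ln 2"
proof (cases "x = 1/2")
  case True
  show ?thesis unfolding True Digamma_one_half by simp
next
  case False
  then show ?thesis
    using Digamma_real_strict_mono [of "1/2" x] assms by (simp add: Digamma_one_half)
qed

text \<open>All digamma arguments are real and at least \<open>1/2\<close>. Each parameter
  contributes at most ln \<pi> + \<gamma> + 2 ln 2, the logarithm of 4 \<pi> exp \<gamma>.\<close>

lemma log_deriv_const_real:
  fixes \<kappa> :: "'n::finite \<Rightarrow> complex"
  assumes "s0 \<in> \<real>" and "\<And>j. \<kappa> j \<in> \<real> \<and> Re (s0 + \<kappa> j) \<ge> 1 \<and> Re (1 - s0 + \<kappa> j) \<ge> 1"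
  shows "Re (log_deriv_const \<kappa> s0) \<le> real CARD('n) * ln (4 * pi * exp euler_mascheroni)"
proof -
  let ?c = "- euler_mascheroni - 2 * ln 2 :: real"
  obtain s where s: "s0 = of_real s" using assms(1) by (auto elim: Reals_cases)
  define k where "k j = Re (\<kappa> j)" for j
  have k: "\<kappa> j = of_real (k j)" for j
    using assms(2) [of j] by (auto simp: k_def elim: Reals_cases)
  have D: "Re (Digamma ((s0 + \<kappa> j) / 2) + Digamma ((1 - s0 + cnj (\<kappa> j)) / 2)) \<ge> 2 * ?c" for j
  proof -
    have ge: "(s + k j) / 2 \<ge> 1 / 2" "(1 - s + k j) / 2 \<ge> 1 / 2"
      using assms(2) [of j] by (auto simp: s k)
    have "Digamma ((s0 + \<kappa> j) / 2) = of_real (Digamma ((s + k j) / 2))"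
      "Digamma ((1 - s0 + cnj (\<kappa> j)) / 2) = of_real (Digamma ((1 - s + k j) / 2))"
      using ge Polygamma_of_real [of "(s + k j) / 2" 0, where 'a = complex]
        Polygamma_of_real [of "(1 - s + k j) / 2" 0, where 'a = complex]
      by (simp_all add: s k)
    then show ?thesis
      using Digamma_real_ge_at_half [OF ge(1)] Digamma_real_ge_at_half [OF ge(2)] by simp
  qed
  have "real CARD('n) * (2 * ?c) \<le> Re (\<Sum>j\<in>UNIV. Digamma ((s0 + \<kappa> j) / 2) + Digamma ((1 - s0 + cnj (\<kappa> j)) / 2))"
    using sum_mono [OF D, of UNIV "\<lambda>j. j"] by simp
  moreover have "ln (4 * pi * exp euler_mascheroni) = ln pi - (?c :: real)"
    using ln_realpow [of 2 2] by (simp add: ln_mult)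
  ultimately show ?thesis
    by (simp add: log_deriv_const_def algebra_simps)
qed


section \<open>Differences of algebraic numbers\<close>

text \<open>The rational span of finitely many products of powers of \<open>x\<close> and
  \<open>y\<close> is stable under multiplication by \<open>x\<close> and by \<open>y\<close>, hence
  by \<open>x - y\<close>. More powers of \<open>x - y\<close> than spanning elements are linearly
  dependent, which gives an annihilating polynomial.\<close>

lemma algebraic_diff:
  fixes x y :: "'a :: field_char_0"
  assumes "algebraic x" "algebraic y"
  shows "algebraic (x - y)"
proof -
  interpret vs: vector_space "\<lambda>(q::rat) (z::'a). of_rat q * z"
    by unfold_locales (simp_all only: distrib_left distrib_right of_rat_add of_rat_mult of_rat_1 mult.assoc mult_1_left)
  \<comment> \<open>The top power is isolated, so that multiplication by \<open>z\<close> can be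
    reduced at the largest exponent.\<close>
  have relation: "\<exists>(n::nat) c. n \<ge> 1 \<and> z ^ n = (\<Sum>i<n. of_rat (c i) * z ^ i)" if alg: "algebraic z" for z :: 'a
  proof -
    obtain p where p: "\<And>i. Polynomial.coeff p i \<in> \<rat>" "p \<noteq> 0" "poly p z = 0"
      using alg unfolding algebraic_altdef by blast
    define n where "n = Polynomial.degree p"
    have "\<exists>c. \<forall>i. Polynomial.coeff p i = of_rat (c i)"
      using p(1) by (intro choice) (auto elim: Rats_cases)
    then obtain c where c: "\<And>i. Polynomial.coeff p i = of_rat (c i)" by blast
    have cn: "c n \<noteq> 0" using c [of n] p(2) by (auto simp: n_def)
    have eq: "(\<Sum>i<n. of_rat (c i) * z ^ i) + of_rat (c n) * z ^ n = 0"
      using p(3) by (simp add: poly_altdef c n_def flip: lessThan_Suc_atMost)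
    then have "of_rat (c n) * z ^ n = - (\<Sum>i<n. of_rat (c i) * z ^ i)"
      by (simp add: add_eq_0_iff)
    then have "of_rat (- 1 / c n) * (- (of_rat (c n) * z ^ n)) = of_rat (- 1 / c n) * (\<Sum>i<n. of_rat (c i) * z ^ i)"
      by simp
    also have "of_rat (- 1 / c n) * (- (of_rat (c n) * z ^ n)) = z ^ n"
      using cn by (simp add: of_rat_divide of_rat_minus)
    also have "of_rat (- 1 / c n) * (\<Sum>i<n. of_rat (c i) * z ^ i) = (\<Sum>i<n. of_rat (- 1 / c n * c i) * z ^ i)"
      by (simp only: sum_distrib_left of_rat_mult mult.assoc)
    finally have "z ^ n = (\<Sum>i<n. of_rat (- 1 / c n * c i) * z ^ i)" .
    moreover have "n \<ge> 1" using eq cn by (cases n) auto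
    ultimately show ?thesis by (intro exI [of _ n] exI [of _ "\<lambda>i. - 1 / c n * c i"]) simp
  qed
  obtain n c where n: "n \<ge> 1" "x ^ n = (\<Sum>i<n. of_rat (c i) * x ^ i)"
    using relation [OF assms(1)] by blast
  obtain m d where m: "m \<ge> 1" "y ^ m = (\<Sum>i<m. of_rat (d i) * y ^ i)"
    using relation [OF assms(2)] by blast
  define B where "B = (\<lambda>(i, j). x ^ i * y ^ j) ` ({..<n} \<times> {..<m})"
  have "finite B" by (simp add: B_def)
  have B: "x ^ i * y ^ j \<in> vs.span B" if "i < n" "j < m" for i j
    using that by (intro vs.span_base) (auto simp: B_def)
  have xB: "x * b \<in> vs.span B" if "b \<in> B" for b
  proof -
    obtain i j where ij: "i < n" "j < m" "b = x ^ i * y ^ j"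
      using \<open>b \<in> B\<close> by (auto simp: B_def)
    show ?thesis
    proof (cases "Suc i < n")
      case True
      then show ?thesis using B [of "Suc i" j] ij by (simp add: mult.assoc)
    next
      case False
      then have "n = Suc i" using ij by simp
      then have "x * b = x ^ n * y ^ j" using ij by (simp add: mult.assoc)
      also have "\<dots> = (\<Sum>i<n. of_rat (c i) * (x ^ i * y ^ j))"
        by (simp only: n(2) sum_distrib_right mult.assoc)
      also have "\<dots> \<in> vs.span B"
        using B ij by (intro vs.span_sum vs.span_scale) auto
      finally show ?thesis .
    qed
  qed
  have yB: "y * b \<in> vs.span B" if "b \<in> B" for b
  proof -
    obtain i j where ij: "i < n" "j < m" "b = x ^ i * y ^ j"
      using \<open>b \<in> B\<close> by (auto simp: B_def)
    show ?thesis
    proof (cases "Suc j < m")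
      case True
      then show ?thesis using B [of i "Suc j"] ij by (simp add: mult.left_commute)
    next
      case False
      then have "m = Suc j" using ij by simp
      then have "y * b = x ^ i * y ^ m" using ij by (simp add: mult.left_commute)
      also have "\<dots> = (\<Sum>j<m. of_rat (d j) * (x ^ i * y ^ j))"
        by (simp only: m(2) sum_distrib_left mult.left_commute)
      also have "\<dots> \<in> vs.span B"
        using B ij by (intro vs.span_sum vs.span_scale) auto
      finally show ?thesis .
    qed
  qed
  have mult: "(x - y) * z \<in> vs.span B" if "z \<in> vs.span B" for z
    using that
  proof (induction rule: vs.span_induct_alt)
    case (step q b z)
    have "(x - y) * (of_rat q * b + z) = of_rat q * (x * b - y * b) + (x - y) * z"
      by (simp add: algebra_simps)
    also have "\<dots> \<in> vs.span B"
      using step xB yB by (intro vs.span_add vs.span_scale vs.span_diff) auto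
    finally show ?case .
  qed (simp add: vs.span_zero)
  define w where "w = x - y"
  have pow: "w ^ k \<in> vs.span B" for k
  proof (induction k)
    case 0
    show ?case using B [of 0 0] n(1) m(1) by simp
  next
    case (Suc k)
    then show ?case using mult by (simp add: w_def)
  qed
  define S where "S = (\<lambda>k. w ^ k) ` {..card B}"
  show "algebraic (x - y)"
    unfolding w_def [symmetric]
  proof (cases "inj_on (\<lambda>k. w ^ k) {..card B}")
    case True
    then have "card S = Suc (card B)" by (simp add: S_def card_image)
    moreover have "S \<subseteq> vs.span B" using pow by (auto simp: S_def)
    ultimately have "vs.dependent S"
      using vs.independent_span_bound [OF \<open>finite B\<close>, of S] by auto
    then obtain u v where u: "v \<in> S" "u v \<noteq> 0" "(\<Sum>v\<in>S. of_rat (u v) * v) = 0"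
      using vs.dependent_finite [of S] by (auto simp: S_def)
    then obtain k where k: "k \<le> card B" "v = w ^ k" by (auto simp: S_def)
    define P where "P = (\<Sum>i\<le>card B. Polynomial.monom (of_rat (u (w ^ i)) :: 'a) i)"
    have coeff: "Polynomial.coeff P i = (if i \<le> card B then of_rat (u (w ^ i)) else 0)" for i
      by (simp add: P_def Polynomial.coeff_sum)
    have "(\<Sum>v\<in>S. of_rat (u v) * v) = (\<Sum>i\<le>card B. of_rat (u (w ^ i)) * w ^ i)"
      unfolding S_def by (subst sum.reindex [OF True]) simp
    then have "poly P w = 0"
      using u(3) by (simp add: P_def poly_sum Polynomial.poly_monom)
    moreover have "P \<noteq> 0"
      using coeff [of k] k u(2) by auto
    ultimately show "algebraic w"
      by (intro algebraicI' [of P]) (auto simp: coeff)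
  next
    case False
    \<comment> \<open>Here \<open>S\<close> may have too few elements to be dependent; a difference
      of two monomials annihilates \<open>w\<close> instead.\<close>
    then obtain i j where ij: "i < j" "w ^ i = w ^ j"
      unfolding inj_on_def by (metis linorder_neqE_nat)
    let ?P = "Polynomial.monom 1 j - Polynomial.monom 1 i :: 'a poly"
    have "Polynomial.coeff ?P j = 1" using ij by simp
    then have "?P \<noteq> 0" by (metis Polynomial.coeff_0 zero_neq_one)
    moreover have "poly ?P w = 0" using ij by (simp add: Polynomial.poly_monom)
    ultimately show "algebraic w" by (intro algebraicI' [of ?P]) auto
  qed
qed


section \<open>Liouville's inequality\<close>

text \<open>The Leibniz expansion has \<open>n!\<close> terms, each a product of \<open>n\<close>
  entries up to sign.\<close>

lemma det_abs_le:
  fixes A :: "real mat"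
  assumes A: "A \<in> carrier_mat n n" and le: "\<And>i j. i < n \<Longrightarrow> j < n \<Longrightarrow> \<bar>A $$ (i, j)\<bar> \<le> K"
  shows "\<bar>Determinant.det A\<bar> \<le> fact n * K ^ n"
proof -
  let ?P = "{p. p permutes {0..<n}}"
  have "\<bar>Determinant.det A\<bar> \<le> (\<Sum>p\<in>?P. \<bar>signof p * (\<Prod>i = 0..<n. A $$ (i, p i))\<bar>)"
    unfolding det_def' [OF A] by (rule sum_abs)
  also have "\<dots> \<le> (\<Sum>p\<in>?P. K ^ n)"
  proof (rule sum_mono)
    fix p assume p: "p \<in> ?P"
    have "\<bar>\<Prod>i = 0..<n. A $$ (i, p i)\<bar> \<le> (\<Prod>i = 0..<n. K)"
      unfolding abs_prod
      by (rule prod_mono) (use p permutes_in_image [of p "{0..<n}"] in \<open>auto intro!: le\<close>)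
    then show "\<bar>signof p * (\<Prod>i = 0..<n. A $$ (i, p i))\<bar> \<le> K ^ n"
      by (simp add: abs_mult sign_def)
  qed
  also have "\<dots> = fact n * K ^ n"
    by (simp add: card_permutations)
  finally show ?thesis .
qed

text \<open>Comparing \<open>det M * v 0\<close> with the adjugate applied to
  \<open>M v = \<beta> v\<close> bounds the eigenvalue \<open>\<beta>\<close> away from zero.\<close>

lemma int_matrix_eigenvalue_lower_bound:
  fixes M :: "nat \<Rightarrow> nat \<Rightarrow> int" and v :: "nat \<Rightarrow> real"
  assumes n: "n \<ge> 1" and eig: "\<And>i. i < n \<Longrightarrow> (\<Sum>j<n. of_int (M i j) * v j) = \<beta> * v i"
    and v0: "v 0 = 1" and V: "\<And>i. i < n \<Longrightarrow> \<bar>v i\<bar> \<le> V"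
    and K: "\<And>i j. i < n \<Longrightarrow> j < n \<Longrightarrow> \<bar>of_int (M i j)\<bar> \<le> K"
    and indep: "\<And>u. (\<Sum>i<n. of_int (u i) * v i) = 0 \<Longrightarrow> (\<forall>i<n. u i = (0::int))"
    and "\<beta> \<noteq> 0"
  shows "1 \<le> \<bar>\<beta>\<bar> * (fact n * K ^ (n - 1) * V)"
proof -
  define A where "A = Matrix.mat n n (\<lambda>(i, j). M i j)"
  define R where "R = map_mat real_of_int A"
  define w where "w = Matrix.vec n v"
  have A: "A \<in> carrier_mat n n" and R: "R \<in> carrier_mat n n" and w: "w \<in> carrier_vec n"
    by (auto simp: A_def R_def w_def)
  have Rij: "R $$ (i, j) = of_int (M i j)" if "i < n" "j < n" for i j
    using that by (simp add: R_def A_def)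
  have Rw: "R *\<^sub>v w = \<beta> \<cdot>\<^sub>v w"
    by (rule eq_vecI) (use eig R w in \<open>auto simp: scalar_prod_def Rij w_def lessThan_atLeast0\<close>)
  \<comment> \<open>An integer vector \<open>u\<close> in the left kernel would make \<beta> times
    the sum of \<open>u i * v i\<close> vanish, an integer relation excluded by
    \<open>indep\<close>.\<close>
  have "Determinant.det A \<noteq> 0"
  proof
    assume "Determinant.det A = 0"
    then have "Determinant.det (transpose_mat A) = 0"
      using det_transpose [OF A] by simp
    then obtain u where u: "u \<in> carrier_vec n" "u \<noteq> 0\<^sub>v n" "transpose_mat A *\<^sub>v u = 0\<^sub>v n"
      using det_0_iff_vec_prod_zero [of "transpose_mat A" n] A by auto
    have uA: "(\<Sum>i<n. u $ i * M i j) = 0" if "j < n" for j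
    proof -
      have "(transpose_mat A *\<^sub>v u) $ j = (\<Sum>i<n. M i j * u $ i)"
        using that u(1) A by (simp add: scalar_prod_def A_def lessThan_atLeast0)
      then show ?thesis using u(3) that by (simp add: mult.commute)
    qed
    have "\<beta> * (\<Sum>i<n. of_int (u $ i) * v i) = (\<Sum>i<n. of_int (u $ i) * (\<Sum>j<n. of_int (M i j) * v j))"
      by (subst sum_distrib_left, rule sum.cong) (simp_all add: eig mult.left_commute)
    also have "\<dots> = (\<Sum>j<n. \<Sum>i<n. of_int (u $ i) * of_int (M i j) * v j)"
      unfolding sum_distrib_left by (subst sum.swap) (simp add: mult_ac)
    also have "\<dots> = (\<Sum>j<n. of_int (\<Sum>i<n. u $ i * M i j) * v j)"
      by (simp add: sum_distrib_right)
    also have "\<dots> = 0" by (simp add: uA)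
    finally have "\<forall>i<n. u $ i = 0"
      using \<open>\<beta> \<noteq> 0\<close> indep [of "\<lambda>i. u $ i"] by simp
    then show False using u(1,2) by auto
  qed
  then have "\<bar>real_of_int (Determinant.det A)\<bar> \<ge> 1"
    by linarith
  then have detR: "\<bar>Determinant.det R\<bar> \<ge> 1"
    unfolding R_def of_int_hom.hom_det .
  have "Determinant.det R \<cdot>\<^sub>v w = (adj_mat R * R) *\<^sub>v w"
    using adj_mat(3) [OF R] w by auto
  also have "\<dots> = \<beta> \<cdot>\<^sub>v (adj_mat R *\<^sub>v w)"
    using adj_mat(1) [OF R] R w Rw by (simp add: mult_mat_vec)
  \<comment> \<open>Index 0 is used because \<open>v 0 = 1\<close>.\<close>
  finally have "(Determinant.det R \<cdot>\<^sub>v w) $ 0 = (\<beta> \<cdot>\<^sub>v (adj_mat R *\<^sub>v w)) $ 0"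
    by simp
  then have "Determinant.det R = \<beta> * (\<Sum>j<n. adj_mat R $$ (0, j) * v j)"
    using n adj_mat(1) [OF R] w by (simp add: w_def v0 scalar_prod_def lessThan_atLeast0)
  then have "1 \<le> \<bar>\<beta>\<bar> * \<bar>\<Sum>j<n. adj_mat R $$ (0, j) * v j\<bar>"
    using detR by (simp add: abs_mult)
  also have "\<dots> \<le> \<bar>\<beta>\<bar> * (fact n * K ^ (n - 1) * V)"
  proof (rule mult_left_mono)
    have "\<bar>adj_mat R $$ (0, j) * v j\<bar> \<le> fact (n - 1) * K ^ (n - 1) * V" if "j < n" for j
    proof -
      have D: "mat_delete R j 0 \<in> carrier_mat (n - 1) (n - 1)"
        using R by (rule mat_delete_carrier)
      have "\<bar>Determinant.det (mat_delete R j 0)\<bar> \<le> fact (n - 1) * K ^ (n - 1)"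
      proof (rule det_abs_le [OF D])
        fix a b assume "a < n - 1" "b < n - 1"
        then show "\<bar>mat_delete R j 0 $$ (a, b)\<bar> \<le> K"
          using R by (auto simp: mat_delete_def Rij intro!: K)
      qed
      moreover have "adj_mat R $$ (0, j) = (- 1) ^ j * Determinant.det (mat_delete R j 0)"
        using R n that by (simp add: adj_mat_def cofactor_def)
      ultimately show ?thesis
        using V [OF that] unfolding abs_mult by (intro mult_mono) (auto simp: abs_mult)
    qed
    then have "(\<Sum>j<n. \<bar>adj_mat R $$ (0, j) * v j\<bar>) \<le> (\<Sum>j<n. fact (n - 1) * K ^ (n - 1) * V)"
      by (intro sum_mono) auto
    also have "\<dots> = fact n * K ^ (n - 1) * V"
      using n by (cases n) (auto simp: algebra_simps)
    finally show "\<bar>\<Sum>j<n. adj_mat R $$ (0, j) * v j\<bar> \<le> fact n * K ^ (n - 1) * V"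
      by (rule order_trans [OF sum_abs])
  qed simp
  finally show ?thesis .
qed

section \<open>Integer polynomials at an algebraic number\<close>

text \<open>Multiplication by \<open>a * \<alpha>\<close> shifts the coefficients, and
  \<open>root\<close> removes the top power. The factor \<open>a\<close> keeps them integral even if
  \<alpha> is not an algebraic integer. Each new coefficient is a sum of two products, hence the
  growth by \<open>2 * A\<close>.\<close>

lemma int_power_reduction:
  fixes \<alpha> :: real and a :: int and c :: "nat \<Rightarrow> int"
  assumes n: "n \<ge> 1" and root: "of_int a * \<alpha> ^ n = (\<Sum>l<n. of_int (c l) * \<alpha> ^ l)"
    and a: "\<bar>a\<bar> \<le> A" and c: "\<And>l. l < n \<Longrightarrow> \<bar>c l\<bar> \<le> A"
  shows "\<exists>e. of_int a ^ j * \<alpha> ^ j = (\<Sum>l<n. of_int (e l) * \<alpha> ^ l) \<and> (\<forall>l<n. \<bar>e l\<bar> \<le> (2 * A) ^ j)"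
proof (induction j)
  case 0
  obtain m where "n = Suc m" using n by (cases n) auto
  then show ?case
    by (intro exI [of _ "\<lambda>l. if l = 0 then 1 else 0"]) (simp add: sum.lessThan_Suc_shift del: sum.lessThan_Suc)
next
  case (Suc j)
  then obtain e where e: "of_int a ^ j * \<alpha> ^ j = (\<Sum>l<n. of_int (e l) * \<alpha> ^ l)"
    and eb: "\<And>l. l < n \<Longrightarrow> \<bar>e l\<bar> \<le> (2 * A) ^ j"
    by blast
  obtain m where m: "n = Suc m" using n by (cases n) auto
  define e' where "e' l = (if l = 0 then 0 else a * e (l - 1)) + e m * c l" for l
  have "of_int a ^ Suc j * \<alpha> ^ Suc j = of_int a * \<alpha> * (of_int a ^ j * \<alpha> ^ j)"
    by simp
  also have "\<dots> = (\<Sum>l<m. of_int (a * e l) * \<alpha> ^ Suc l) + of_int (e m) * (of_int a * \<alpha> ^ n)"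
    unfolding e m by (simp add: sum_distrib_left algebra_simps)
  also have "(\<Sum>l<m. of_int (a * e l) * \<alpha> ^ Suc l) =
      (\<Sum>l<n. of_int (if l = 0 then 0 else a * e (l - 1)) * \<alpha> ^ l)"
    unfolding m sum.lessThan_Suc_shift by simp
  also have "of_int (e m) * (of_int a * \<alpha> ^ n) = (\<Sum>l<n. of_int (e m * c l) * \<alpha> ^ l)"
    unfolding root by (simp add: sum_distrib_left mult_ac)
  finally have "of_int a ^ Suc j * \<alpha> ^ Suc j = (\<Sum>l<n. of_int (e' l) * \<alpha> ^ l)"
    by (simp add: e'_def sum.distrib algebra_simps)
  moreover have "\<bar>e' l\<bar> \<le> (2 * A) ^ Suc j" if "l < n" for l
  proof -
    have A: "A \<ge> 0" using a by linarith
    have "\<bar>a * e (l - 1)\<bar> \<le> A * (2 * A) ^ j"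
      unfolding abs_mult using that A a by (intro mult_mono eb) auto
    moreover have "\<bar>e m * c l\<bar> \<le> (2 * A) ^ j * A"
      unfolding abs_mult using that A m by (intro mult_mono eb c) auto
    moreover have "0 \<le> A * (2 * A) ^ j" using A by simp
    ultimately show ?thesis
      unfolding e'_def by (auto simp: algebra_simps)
  qed
  ultimately show ?case by blast
qed

text \<open>Multiplication by the value of the polynomial acts on the first \<open>n\<close> powers
  of \<alpha>, after scaling by a power of the leading coefficient, as an integer matrix, whose
  eigenvalue is bounded below. It matters that the bound is geometric in \<open>p\<close> and of
  degree \<open>n - 1\<close> in \<open>H\<close>.\<close>

lemma liouville_bound_poly:
  fixes \<alpha> :: real
  assumes "algebraic \<alpha>"
  obtains n :: nat and C :: real where "n \<ge> 1" "C \<ge> 1"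
    "\<And>p t H. (\<And>j. j < p \<Longrightarrow> \<bar>t j\<bar> \<le> H) \<Longrightarrow> (\<Sum>j<p. of_int (t j) * \<alpha> ^ j) \<noteq> 0 \<Longrightarrow>
       1 \<le> C ^ (p + 1) * real_of_int H ^ (n - 1) * \<bar>\<Sum>j<p. of_int (t j) * \<alpha> ^ j\<bar>"
proof -
  \<comment> \<open>\<open>P n\<close> is integer dependence of the first \<open>n\<close> powers;
    the least such number exceeds the degree of \<alpha> by one.\<close>
  define P where "P n \<longleftrightarrow> (\<exists>u :: nat \<Rightarrow> int. (\<Sum>i<n. of_int (u i) * \<alpha> ^ i) = 0 \<and> (\<exists>i<n. u i \<noteq> 0))" for n
  have "\<exists>n. P n"
  proof -
    obtain q where q: "\<And>i. coeff q i \<in> \<int>" "q \<noteq> 0" "poly q \<alpha> = 0"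
      using algebraicE [OF assms] by blast
    define c where "c i = \<lfloor>coeff q i\<rfloor>" for i
    have c: "of_int (c i) = coeff q i" for i
      using q(1) [of i] unfolding c_def by (metis Ints_cases floor_of_int)
    have "(\<Sum>i<Suc (degree q). of_int (c i) * \<alpha> ^ i) = 0"
      using q(3) by (simp only: c poly_altdef lessThan_Suc_atMost)
    moreover have "c (degree q) \<noteq> 0"
      using c [of "degree q"] q(2) by auto
    ultimately have "P (Suc (degree q))"
      unfolding P_def by blast
    then show ?thesis ..
  qed
  then obtain k where k: "P k" "\<And>m. m < k \<Longrightarrow> \<not> P m"
    using exists_least_iff [of P] by blast
  moreover have "\<not> P 0" by (simp add: P_def)
  ultimately obtain n where n: "k = Suc n" by (metis not0_implies_Suc)
  obtain u where u: "(\<Sum>i<Suc n. of_int (u i) * \<alpha> ^ i) = 0" "\<exists>i<Suc n. u i \<noteq> 0"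
    using k(1) unfolding n P_def by blast
  have indep: "\<forall>i<n. u i = 0" if "(\<Sum>i<n. of_int (u i) * \<alpha> ^ i) = 0" for u :: "nat \<Rightarrow> int"
    using k(2) [of n] that unfolding n P_def by blast
  have un: "u n \<noteq> 0"
  proof
    assume "u n = 0"
    then show False using u indep [of u] by (auto simp: less_Suc_eq)
  qed
  have n1: "n \<ge> 1"
    using u un by (cases n) auto
  define a where "a = u n"
  define A where "A = (\<Sum>i\<le>n. \<bar>u i\<bar>)"
  have uA: "\<bar>u i\<bar> \<le> A" if "i \<le> n" for i
    unfolding A_def using that by (intro member_le_sum) auto
  have A1: "A \<ge> 1" using uA [of n] un by linarith
  have root: "of_int a * \<alpha> ^ n = (\<Sum>l<n. of_int (- u l) * \<alpha> ^ l)"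
    using u(1) by (simp add: a_def sum_negf)
  have "\<exists>e. \<forall>j. of_int a ^ j * \<alpha> ^ j = (\<Sum>l<n. of_int (e j l) * \<alpha> ^ l) \<and> (\<forall>l<n. \<bar>e j l\<bar> \<le> (2 * A) ^ j)"
    by (intro choice allI int_power_reduction [OF n1 root]) (use uA in \<open>auto simp: a_def\<close>)
  then obtain e where e: "\<And>j. of_int a ^ j * \<alpha> ^ j = (\<Sum>l<n. of_int (e j l) * \<alpha> ^ l)"
    and eb: "\<And>j l. l < n \<Longrightarrow> \<bar>e j l\<bar> \<le> (2 * A) ^ j"
    by metis
  define V where "V = (\<Sum>i<n. \<bar>\<alpha> ^ i\<bar>) + 1"
  define B where "B = real_of_int (4 * A)"
  have B1: "B \<ge> 1" using A1 by (simp add: B_def)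
  have V1: "V \<ge> 1" by (simp add: V_def sum_nonneg)
  have bound: "1 \<le> (B ^ (n * n) * fact n * V) * (B ^ n) ^ p * real_of_int H ^ (n - 1) * \<bar>\<Sum>j<p. of_int (t j) * \<alpha> ^ j\<bar>"
    if t: "\<And>j. j < p \<Longrightarrow> \<bar>t j\<bar> \<le> H" and nz: "(\<Sum>j<p. of_int (t j) * \<alpha> ^ j) \<noteq> 0"
    for p and t :: "nat \<Rightarrow> int" and H
  proof -
    define T where "T = (\<Sum>j<p. of_int (t j) * \<alpha> ^ j)"
    have "p > 0" using nz by (cases p) auto
    then have H0: "H \<ge> 0" using t [of 0] by linarith
    \<comment> \<open>Row \<open>i\<close> expresses \<open>a ^ (p + n) * T * \<alpha> ^ i\<close>:
      reducing \<open>\<alpha> ^ (i + j)\<close> uses up \<open>a ^ (i + j)\<close>, and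
      \<open>i + j < p + n\<close>.\<close>
    define M where "M i l = (\<Sum>j<p. t j * a ^ (p + n - (i + j)) * e (i + j) l)" for i l
    define \<beta> where "\<beta> = of_int a ^ (p + n) * T"
    have eig: "(\<Sum>l<n. of_int (M i l) * \<alpha> ^ l) = \<beta> * \<alpha> ^ i" if "i < n" for i
    proof -
      have "(\<Sum>l<n. of_int (M i l) * \<alpha> ^ l) =
          (\<Sum>l<n. \<Sum>j<p. of_int (t j) * of_int a ^ (p + n - (i + j)) * (of_int (e (i + j) l) * \<alpha> ^ l))"
        by (simp only: M_def of_int_sum sum_distrib_right of_int_mult of_int_power mult.assoc)
      also have "\<dots> = (\<Sum>j<p. of_int (t j) * of_int a ^ (p + n - (i + j)) * (of_int a ^ (i + j) * \<alpha> ^ (i + j)))"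
        unfolding e by (subst sum.swap) (simp add: sum_distrib_left)
      also have "\<dots> = (\<Sum>j<p. of_int (t j) * of_int a ^ (p + n) * \<alpha> ^ (i + j))"
      proof (rule sum.cong [OF refl])
        fix j assume "j \<in> {..<p}"
        then have "p + n = (p + n - (i + j)) + (i + j)" using that by simp
        then have "of_int a ^ (p + n) = (of_int a ^ (p + n - (i + j)) * of_int a ^ (i + j) :: real)"
          by (metis power_add)
        then show "of_int (t j) * of_int a ^ (p + n - (i + j)) * (of_int a ^ (i + j) * \<alpha> ^ (i + j)) =
            of_int (t j) * of_int a ^ (p + n) * \<alpha> ^ (i + j)"
          by simp
      qed
      also have "\<dots> = \<beta> * \<alpha> ^ i"
        by (simp add: \<beta>_def T_def sum_distrib_left sum_distrib_right power_add mult_ac)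
      finally show ?thesis .
    qed
    have Mb: "\<bar>real_of_int (M i l)\<bar> \<le> real_of_int H * B ^ (p + n)" if "i < n" "l < n" for i l
    proof -
      have "\<bar>M i l\<bar> \<le> (\<Sum>j<p. \<bar>t j * a ^ (p + n - (i + j)) * e (i + j) l\<bar>)"
        unfolding M_def by (rule sum_abs)
      also have "\<dots> \<le> (\<Sum>j<p. H * (2 * A) ^ (p + n))"
      proof (rule sum_mono)
        fix j assume j: "j \<in> {..<p}"
        have "\<bar>a\<bar> ^ (p + n - (i + j)) \<le> (2 * A) ^ (p + n - (i + j))"
          using uA [of n] A1 by (intro power_mono) (auto simp: a_def)
        then have "\<bar>t j * a ^ (p + n - (i + j)) * e (i + j) l\<bar> \<le>
            H * (2 * A) ^ (p + n - (i + j)) * (2 * A) ^ (i + j)"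
          unfolding abs_mult power_abs
          using j t H0 A1 that by (intro mult_mono eb) auto
        also have "\<dots> = H * (2 * A) ^ ((p + n - (i + j)) + (i + j))"
          by (simp only: mult.assoc power_add)
        also have "(p + n - (i + j)) + (i + j) = p + n"
          using j that by simp
        finally show "\<bar>t j * a ^ (p + n - (i + j)) * e (i + j) l\<bar> \<le> H * (2 * A) ^ (p + n)" .
      qed
      also have "\<dots> = int p * (H * (2 * A) ^ (p + n))" by simp
      \<comment> \<open>The number of summands is absorbed by a power of 2, whence
        \<open>4 * A\<close> in \<open>B\<close>.\<close>
      also have "\<dots> \<le> 2 ^ (p + n) * (H * (2 * A) ^ (p + n))"
      proof (rule mult_right_mono)
        have "p < 2 ^ p" by (rule less_exp)
        also have "(2::nat) ^ p \<le> 2 ^ (p + n)" by (rule power_increasing) auto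
        finally have "p \<le> 2 ^ (p + n)" by simp
        then show "int p \<le> 2 ^ (p + n)" by (metis of_nat_le_iff of_nat_numeral of_nat_power)
      qed (use H0 A1 in auto)
      also have "\<dots> = H * (4 * A) ^ (p + n)"
        by (simp add: power_mult_distrib flip: power_mult_distrib [of 2 2])
      finally have "real_of_int \<bar>M i l\<bar> \<le> real_of_int (H * (4 * A) ^ (p + n))"
        by (simp only: of_int_le_iff)
      then show ?thesis by (simp add: B_def)
    qed
    have "\<beta> \<noteq> 0" using nz un by (simp add: \<beta>_def T_def a_def)
    moreover have "\<bar>\<alpha> ^ i\<bar> \<le> V" if "i < n" for i
    proof -
      have "\<bar>\<alpha> ^ i\<bar> \<le> (\<Sum>i<n. \<bar>\<alpha> ^ i\<bar>)" using that by (intro member_le_sum) auto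
      then show ?thesis by (simp add: V_def)
    qed
    ultimately have "1 \<le> \<bar>\<beta>\<bar> * (fact n * (real_of_int H * B ^ (p + n)) ^ (n - 1) * V)"
      using eig Mb n1 indep
      by (intro int_matrix_eigenvalue_lower_bound [where M = M and v = "\<lambda>i. \<alpha> ^ i"]) auto
    also have "\<dots> \<le> (B ^ (p + n) * \<bar>T\<bar>) * (fact n * (real_of_int H * B ^ (p + n)) ^ (n - 1) * V)"
    proof (rule mult_right_mono)
      have "\<bar>real_of_int a\<bar> \<le> B" using uA [of n] A1 by (simp add: a_def B_def)
      then show "\<bar>\<beta>\<bar> \<le> B ^ (p + n) * \<bar>T\<bar>"
        unfolding \<beta>_def abs_mult power_abs by (intro mult_right_mono power_mono) auto
    qed (use H0 B1 V1 in auto)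
    also have "\<dots> = fact n * V * (B ^ (p + n)) ^ Suc (n - 1) * real_of_int H ^ (n - 1) * \<bar>T\<bar>"
      by (simp add: power_mult_distrib mult_ac)
    also have "Suc (n - 1) = n" using n1 by simp
    also have "(B ^ (p + n)) ^ n = B ^ (n * n) * (B ^ n) ^ p"
      by (simp add: power_add power_mult_distrib flip: power_mult) (simp add: mult.commute)
    finally show ?thesis by (simp add: T_def mult_ac)
  qed
  \<comment> \<open>\<open>C\<close> dominates both the factor independent of \<open>p\<close> and
    the base \<open>B ^ n\<close>, as both are at least 1.\<close>
  define C where "C = B ^ (n * n) * fact n * V * B ^ n"
  show thesis
  proof (rule that [OF n1, of C])
    have D1: "B ^ (n * n) * fact n * V \<ge> 1" and Bn: "B ^ n \<ge> 1"
      using B1 V1 by (auto intro!: mult_ge1_I one_le_power simp: fact_ge_1)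
    then show "C \<ge> 1" unfolding C_def by (rule mult_ge1_I)
    fix p :: nat and t :: "nat \<Rightarrow> int" and H
    assume t: "\<And>j. j < p \<Longrightarrow> \<bar>t j\<bar> \<le> H" and nz: "(\<Sum>j<p. of_int (t j) * \<alpha> ^ j) \<noteq> 0"
    have "p > 0" using nz by (cases p) auto
    then have H0: "H \<ge> 0" using t [of 0] by linarith
    have "B ^ (n * n) * fact n * V * (B ^ n) ^ p \<le> C * C ^ p"
    proof (rule mult_mono)
      show "B ^ (n * n) * fact n * V \<le> C"
        unfolding C_def using D1 mult_left_mono [OF Bn, of "B ^ (n * n) * fact n * V"] by simp
      show "(B ^ n) ^ p \<le> C ^ p"
        unfolding C_def using Bn mult_right_mono [OF D1, of "B ^ n"] by (intro power_mono) simp_all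
    qed (use D1 Bn C_def in auto)
    then have "B ^ (n * n) * fact n * V * (B ^ n) ^ p * real_of_int H ^ (n - 1) * \<bar>\<Sum>j<p. of_int (t j) * \<alpha> ^ j\<bar> \<le>
        C * C ^ p * real_of_int H ^ (n - 1) * \<bar>\<Sum>j<p. of_int (t j) * \<alpha> ^ j\<bar>"
      using H0 by (intro mult_right_mono) auto
    with bound [OF t nz]
    show "1 \<le> C ^ (p + 1) * real_of_int H ^ (n - 1) * \<bar>\<Sum>j<p. of_int (t j) * \<alpha> ^ j\<bar>"
      by simp
  qed
qed


section \<open>Hermite's approximations to exponentials\<close>

text \<open>With \<open>b j\<close> read as the coefficient of \<open>x ^ j / j!\<close>, this solves \<open>c f + f' = g\<close> in polynomials.\<close>

lemma antiderivative_coeffs: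
  fixes b :: "nat \<Rightarrow> real" and c L :: int
  assumes "c \<noteq> 0" "c dvd L" "d \<le> s" and "\<And>j. j \<ge> d \<Longrightarrow> b j = 0"
    and "\<And>j. of_int L ^ (s - 1 - j) * b j \<in> \<int>"
  shows "\<exists>b'. (\<forall>j. of_int c * b' j + b' (Suc j) = b j) \<and> (\<forall>j\<ge>d. b' j = 0) \<and>
    (\<forall>j. of_int L ^ (s - j) * b' j \<in> \<int>) \<and>
    (\<Sum>j<d. \<bar>b' j\<bar> * 2 ^ j) + \<bar>b' 0\<bar> \<le> 2 * (\<Sum>j<d. \<bar>b j\<bar> * 2 ^ j)"
  using assms
proof (induction d arbitrary: b s)
  case 0
  then show ?case by (intro exI [of _ "\<lambda>_. 0"]) auto
next
  case (Suc d)
  have int: "of_int L ^ (s - 1 - 1 - j) * b (Suc j) \<in> \<int>" for j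
    using Suc.prems(5) [of "Suc j"] by simp
  obtain r where r: "\<And>j. of_int c * r j + r (Suc j) = b (Suc j)" "\<And>j. j \<ge> d \<Longrightarrow> r j = 0"
      "\<And>j. of_int L ^ (s - 1 - j) * r j \<in> \<int>"
      "(\<Sum>j<d. \<bar>r j\<bar> * 2 ^ j) + \<bar>r 0\<bar> \<le> 2 * (\<Sum>j<d. \<bar>b (Suc j)\<bar> * 2 ^ j)"
    using Suc.IH [of "s - 1" "\<lambda>j. b (Suc j)"] Suc.prems int by fastforce
  \<comment> \<open>Above index 0 the solution is \<open>r\<close>, which solves the shifted
    problem. The equation at index 0 costs a division by \<open>c\<close>, hence one more factor
    \<open>L\<close>.\<close>
  define b' where "b' = case_nat ((b 0 - r 0) / of_int c) r"
  have b'[simp]: "b' 0 = (b 0 - r 0) / of_int c" "b' (Suc j) = r j" for j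
    by (simp_all add: b'_def)
  have "of_int c * b' j + b' (Suc j) = b j" for j
    using r(1) Suc.prems(1) by (cases j) auto
  moreover have "b' j = 0" if "j \<ge> Suc d" for j
    using that r(2) by (cases j) auto
  moreover have "of_int L ^ (s - j) * b' j \<in> \<int>" for j
  proof (cases j)
    case 0
    obtain l where l: "L = c * l" using Suc.prems(2) by blast
    have s: "s = Suc (s - 1)" using Suc.prems(3) by simp
    have "of_int L ^ s * b' 0 = of_int l * (of_int L ^ (s - 1) * b 0 - of_int L ^ (s - 1) * r 0)"
      using Suc.prems(1) by (subst s) (simp add: l field_simps)
    also have "\<dots> \<in> \<int>"
      using Suc.prems(5) [of 0] r(3) [of 0] by (intro Ints_mult [OF Ints_of_int Ints_diff]) auto
    finally show ?thesis using 0 by simp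
  next
    case (Suc i)
    then show ?thesis using r(3) [of i] by simp
  qed
  moreover have "(\<Sum>j<Suc d. \<bar>b' j\<bar> * 2 ^ j) + \<bar>b' 0\<bar> \<le> 2 * (\<Sum>j<Suc d. \<bar>b j\<bar> * 2 ^ j)"
  proof -
    have "\<bar>b' 0\<bar> \<le> \<bar>b 0\<bar> + \<bar>r 0\<bar>"
    proof -
      have "\<bar>b' 0\<bar> = \<bar>b 0 - r 0\<bar> / of_int \<bar>c\<bar>" by simp
      also have "\<dots> \<le> \<bar>b 0 - r 0\<bar> / 1"
        using Suc.prems(1) by (intro divide_left_mono) auto
      finally show ?thesis by simp
    qed
    \<comment> \<open>A shift of the index doubles the weights, and the extra summand
      \<open>\<bar>r 0\<bar>\<close> in \<open>r(4)\<close> pays for \<open>r 0\<close> in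
      \<open>b' 0\<close>.\<close>
    moreover have "(\<Sum>j<Suc d. \<bar>f j\<bar> * 2 ^ j) = \<bar>f 0\<bar> + 2 * (\<Sum>j<d. \<bar>f (Suc j)\<bar> * 2 ^ j)"
      for f :: "nat \<Rightarrow> real"
      unfolding sum.lessThan_Suc_shift by (simp add: sum_distrib_left mult_ac)
    ultimately show ?thesis
      using r(4) unfolding b'(2) by (simp del: b'(1))
  qed
  ultimately show ?case by blast
qed

definition exp_poly :: "nat \<Rightarrow> nat \<Rightarrow> (nat \<Rightarrow> nat \<Rightarrow> real) \<Rightarrow> real \<Rightarrow> real" where
  "exp_poly m d b x = (\<Sum>k\<le>m. exp (real k * x) * (\<Sum>j<d. b k j * (x ^ j / fact j)))"

lemma has_field_derivative_power_fact:
  "((\<lambda>x::real. x ^ Suc j / fact (Suc j)) has_field_derivative x ^ j / fact j) (at x)"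
  using DERIV_cdivide [OF DERIV_pow [of "Suc j" x UNIV], of "fact (Suc j)"]
  by (simp del: of_nat_Suc)

text \<open>In the basis \<open>x ^ j / fact j\<close> differentiation shifts coefficients, so the
  linear equation becomes a recursion. The vanishing coefficients pad the sums to equal
  length.\<close>

lemma has_field_derivative_exp_poly:
  assumes rec: "\<And>k j. k \<le> m \<Longrightarrow> real k * b' k j + b' k (Suc j) = c * b' k j + b k j"
    and 0: "\<And>k. k \<le> m \<Longrightarrow> b' k (Suc d) = 0" "\<And>k. k \<le> m \<Longrightarrow> b k d = 0"
  shows "(exp_poly m (Suc d) b' has_field_derivative
    c * exp_poly m (Suc d) b' x + exp_poly m d b x) (at x)"
proof -
  let ?p = "\<lambda>j. x ^ j / fact j"
  have term_deriv: "((\<lambda>x. exp (real k * x) * (\<Sum>j<Suc d. b' k j * (x ^ j / fact j))) has_field_derivative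
      exp (real k * x) * (\<Sum>j<Suc d. (c * b' k j + b k j) * ?p j)) (at x)" if k: "k \<le> m" for k
  proof -
    have dsum: "((\<lambda>x. \<Sum>j<Suc d. b' k j * (x ^ j / fact j)) has_field_derivative
        (\<Sum>j<d. b' k (Suc j) * ?p j)) (at x)"
    proof -
      have "((\<lambda>x. \<Sum>j<d. b' k (Suc j) * (x ^ Suc j / fact (Suc j))) has_field_derivative
          (\<Sum>j<d. b' k (Suc j) * ?p j)) (at x)"
        by (intro DERIV_sum DERIV_cmult has_field_derivative_power_fact)
      from DERIV_add [OF DERIV_const [of "b' k 0"] this] show ?thesis
        unfolding sum.lessThan_Suc_shift by simp
    qed
    have dexp: "((\<lambda>x. exp (real k * x)) has_field_derivative exp (real k * x) * real k) (at x)"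
      by (auto intro!: derivative_eq_intros)
    have eq: "(\<Sum>j<d. b' k (Suc j) * ?p j) = (\<Sum>j<Suc d. b' k (Suc j) * ?p j)"
      using 0(1) [OF k] by simp
    have "((\<lambda>x. exp (real k * x) * (\<Sum>j<Suc d. b' k j * (x ^ j / fact j))) has_field_derivative
        exp (real k * x) * (\<Sum>j<Suc d. b' k (Suc j) * ?p j) +
        exp (real k * x) * real k * (\<Sum>j<Suc d. b' k j * ?p j)) (at x)"
      by (rule DERIV_mult' [OF dexp dsum [unfolded eq]])
    also have "exp (real k * x) * (\<Sum>j<Suc d. b' k (Suc j) * ?p j) +
        exp (real k * x) * real k * (\<Sum>j<Suc d. b' k j * ?p j) =
        exp (real k * x) * (real k * (\<Sum>j<Suc d. b' k j * ?p j) + (\<Sum>j<Suc d. b' k (Suc j) * ?p j))"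
      by (simp only: distrib_left mult.assoc add.commute)
    also have "real k * (\<Sum>j<Suc d. b' k j * ?p j) + (\<Sum>j<Suc d. b' k (Suc j) * ?p j) =
        (\<Sum>j<Suc d. (c * b' k j + b k j) * ?p j)"
      unfolding rec [OF k, symmetric] by (simp only: sum_distrib_left sum.distrib [symmetric] algebra_simps)
    finally show ?thesis .
  qed
  have "(exp_poly m (Suc d) b' has_field_derivative
      (\<Sum>k\<le>m. exp (real k * x) * (\<Sum>j<Suc d. (c * b' k j + b k j) * ?p j))) (at x)"
    unfolding exp_poly_def [abs_def] by (intro DERIV_sum term_deriv) auto
  also have "(\<Sum>k\<le>m. exp (real k * x) * (\<Sum>j<Suc d. (c * b' k j + b k j) * ?p j)) =
      (\<Sum>k\<le>m. c * (exp (real k * x) * (\<Sum>j<Suc d. b' k j * ?p j)) + exp (real k * x) * (\<Sum>j<d. b k j * ?p j))"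
  proof (rule sum.cong [OF refl])
    fix k assume "k \<in> {..m}"
    then have "(\<Sum>j<d. b k j * ?p j) = (\<Sum>j<Suc d. b k j * ?p j)" using 0(2) by simp
    moreover have "(\<Sum>j<Suc d. (c * b' k j + b k j) * ?p j) =
        c * (\<Sum>j<Suc d. b' k j * ?p j) + (\<Sum>j<Suc d. b k j * ?p j)"
      by (simp only: sum_distrib_left sum.distrib [symmetric] algebra_simps)
    ultimately show "exp (real k * x) * (\<Sum>j<Suc d. (c * b' k j + b k j) * ?p j) =
        c * (exp (real k * x) * (\<Sum>j<Suc d. b' k j * ?p j)) + exp (real k * x) * (\<Sum>j<d. b k j * ?p j)"
      by (simp only: distrib_left mult.left_commute)
  qed
  also have "\<dots> = c * exp_poly m (Suc d) b' x + exp_poly m d b x"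
    by (simp add: exp_poly_def sum.distrib sum_distrib_left del: sum.lessThan_Suc)
  finally show ?thesis .
qed

text \<open>With the integrating factor \<open>exp (- k * t)\<close> the derivative of
  \<open>f\<close> becomes a multiple of \<open>g\<close>. As \<open>k \<le> m\<close>, the factor
  \<open>exp (m * x)\<close> survives every iteration while \<open>x ^ s / fact s\<close> is
  integrated once.\<close>

lemma linear_ode_bounds:
  fixes f g :: "real \<Rightarrow> real"
  assumes ode: "\<And>x. (f has_field_derivative k * f x + g x) (at x)" and "f 0 = 0" "k \<le> m"
    and g: "\<And>x. x > 0 \<Longrightarrow> 0 < g x \<and> g x \<le> exp (m * x) * (x ^ s / fact s)"
    and x: "x > 0"
  shows "0 < f x \<and> f x \<le> exp (m * x) * (x ^ Suc s / fact (Suc s))"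
proof -
  define h where "h t = exp (- k * t) * f t" for t
  \<comment> \<open>This is the claimed bound minus \<open>f\<close>, times the integrating factor;
    its derivative is nonnegative for positive \<open>t\<close>.\<close>
  define e where "e t = exp ((m - k) * t) * (t ^ Suc s / fact (Suc s)) - h t" for t
  have dh: "(h has_field_derivative exp (- k * t) * g t) (at t)" for t
    unfolding h_def [abs_def] by (auto intro!: derivative_eq_intros ode simp: algebra_simps)
  have "h 0 < h x"
  proof (rule DERIV_pos_imp_increasing_open [where f = h, OF x])
    show "\<exists>y. DERIV h t :> y \<and> y > 0" if "0 < t" "t < x" for t
      using dh [of t] g [OF that(1)] by (meson exp_gt_zero mult_pos_pos)
    show "continuous_on {0..x} h"
      by (intro continuous_at_imp_continuous_on ballI) (rule DERIV_isCont [OF dh])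
  qed
  then have pos: "0 < f x"
    using \<open>f 0 = 0\<close> by (simp add: h_def zero_less_mult_iff)
  have de: "(e has_field_derivative (m - k) * exp ((m - k) * t) * (t ^ Suc s / fact (Suc s))
      + exp ((m - k) * t) * (t ^ s / fact s) - exp (- k * t) * g t) (at t)" for t
  proof -
    have "((\<lambda>t. exp ((m - k) * t)) has_field_derivative exp ((m - k) * t) * (m - k)) (at t)"
      by (auto intro!: derivative_eq_intros)
    from DERIV_diff [OF DERIV_mult' [OF this has_field_derivative_power_fact] dh]
    show ?thesis
      unfolding e_def [abs_def] by (rule DERIV_cong) (simp only: mult_ac add_ac)
  qed
  have "e 0 \<le> e x"
  proof (rule DERIV_nonneg_imp_increasing_open [where f = e and a = 0 and b = x])
    show "\<exists>y. DERIV e t :> y \<and> y \<ge> 0" if t: "0 < t" "t < x" for t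
    proof (intro exI conjI, rule de)
      have "exp (- k * t) * g t \<le> exp (- k * t) * (exp (m * t) * (t ^ s / fact s))"
        using g [OF t(1)] by (intro mult_left_mono) auto
      also have "\<dots> = exp ((m - k) * t) * (t ^ s / fact s)"
        by (simp add: algebra_simps flip: exp_add mult.assoc)
      finally have "exp (- k * t) * g t \<le> exp ((m - k) * t) * (t ^ s / fact s)" .
      moreover have "0 \<le> (m - k) * exp ((m - k) * t) * (t ^ Suc s / fact (Suc s))"
        using t \<open>k \<le> m\<close> by (intro mult_nonneg_nonneg divide_nonneg_pos) auto
      ultimately show "0 \<le> (m - k) * exp ((m - k) * t) * (t ^ Suc s / fact (Suc s))
          + exp ((m - k) * t) * (t ^ s / fact s) - exp (- k * t) * g t" by linarith
    qed
    show "continuous_on {0..x} e"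
      by (intro continuous_at_imp_continuous_on ballI) (rule DERIV_isCont [OF de])
  qed (use x in auto)
  then have "exp (- k * x) * f x \<le> exp ((m - k) * x) * (x ^ Suc s / fact (Suc s))"
    using \<open>f 0 = 0\<close> by (simp add: e_def h_def)
  then have "exp (k * x) * (exp (- k * x) * f x) \<le> exp (k * x) * (exp ((m - k) * x) * (x ^ Suc s / fact (Suc s)))"
    by (intro mult_left_mono) auto
  also have "\<dots> = exp (m * x) * (x ^ Suc s / fact (Suc s))"
    by (simp only: mult.assoc [symmetric] exp_add [symmetric]) (simp add: algebra_simps)
  also have "exp (k * x) * (exp (- k * x) * f x) = f x"
    by (simp add: mult.assoc [symmetric] flip: exp_add)
  finally show ?thesis using pos by blast
qed

text \<open>Hermite's approximations of type I: prepending \<open>k\<close> to the list solves \<open>f' = k f + g\<close> with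
  \<open>f 0 = 0\<close>, so each entry of the list raises the order of vanishing at \<open>0\<close> by one. The weights
  \<open>2 ^ j\<close> make the size of the coefficients grow only geometrically.\<close>

lemma hermite_pade_exp:
  assumes "ks \<noteq> []" "set ks \<subseteq> {..m}"
  shows "\<exists>b. (\<forall>k j. count_list ks k \<le> j \<longrightarrow> b k j = 0) \<and>
    (\<forall>k j. of_int (fact m) ^ (length ks - 1 - j) * b k j \<in> \<int>) \<and>
    (\<Sum>k\<le>m. \<Sum>j<length ks. \<bar>b k j\<bar> * 2 ^ j) \<le> 2 ^ length ks \<and>
    (\<forall>x>0. 0 < exp_poly m (length ks) b x \<and>
      exp_poly m (length ks) b x \<le> exp (real m * x) * (x ^ (length ks - 1) / fact (length ks - 1)))"
  using assms
proof (induction ks)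
  case (Cons k0 ks)
  then have k0: "k0 \<le> m" by simp
  show ?case
  proof (cases "ks = []")
    case True
    \<comment> \<open>A single entry gives \<open>exp (k0 * x)\<close>, which is nonzero at 0; so
      the exponent in the bound is the length minus one.\<close>
    define b where "b k j = (if k = k0 \<and> j = 0 then 1 else 0 :: real)" for k j :: nat
    have "exp_poly m 1 b x = exp (real k0 * x)" for x
    proof -
      have "exp_poly m 1 b x = (\<Sum>k\<le>m. if k = k0 then exp (real k * x) else 0)"
        unfolding exp_poly_def by (rule sum.cong) (auto simp: b_def)
      then show ?thesis using k0 by simp
    qed
    moreover have "(\<Sum>k\<le>m. \<Sum>j<1. \<bar>b k j\<bar> * 2 ^ j) = 1"
    proof -
      have "(\<Sum>k\<le>m. \<Sum>j<1. \<bar>b k j\<bar> * 2 ^ j) = (\<Sum>k\<le>m. if k = k0 then 1 else 0)"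
        by (rule sum.cong) (auto simp: b_def)
      then show ?thesis using k0 by simp
    qed
    moreover have "\<forall>k j. count_list [k0] k \<le> j \<longrightarrow> b k j = 0"
      and "\<forall>k j. of_int (fact m) ^ (length [k0] - 1 - j) * b k j \<in> \<int>"
      by (auto simp: b_def)
    ultimately show ?thesis
      using True k0 by (intro exI [of _ b]) (simp add: mult_right_mono)
  next
    case False
    define s where "s = length ks"
    define L where "L = (fact m :: int)"
    have "s \<ge> 1" using False by (cases ks) (auto simp: s_def)
    obtain b where supp: "\<And>k j. count_list ks k \<le> j \<Longrightarrow> b k j = 0"
      and int: "\<And>k j. of_int L ^ (s - 1 - j) * b k j \<in> \<int>"
      and size: "(\<Sum>k\<le>m. \<Sum>j<s. \<bar>b k j\<bar> * 2 ^ j) \<le> 2 ^ s"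
      and bounds: "\<And>x. x > 0 \<Longrightarrow> 0 < exp_poly m s b x \<and>
        exp_poly m s b x \<le> exp (real m * x) * (x ^ (s - 1) / fact (s - 1))"
      using Cons.IH [OF False] Cons.prems(2) unfolding s_def L_def by auto
    have supp_s: "b k j = 0" if "j \<ge> s" for k j
      using supp [of k j] that count_le_length [of ks k] by (simp add: s_def)
    \<comment> \<open>For \<open>k\<close> other than \<open>k0\<close> the equation has the nonzero
      constant \<open>k - k0\<close>, which divides \<open>fact m\<close>.\<close>
    define Q where "Q k r \<longleftrightarrow> (\<forall>j. of_int (int k - int k0) * r j + r (Suc j) = b k j) \<and>
        (\<forall>j\<ge>count_list ks k. r j = 0) \<and> (\<forall>j. of_int L ^ (s - j) * r j \<in> \<int>) \<and>
        (\<Sum>j<count_list ks k. \<bar>r j\<bar> * 2 ^ j) + \<bar>r 0\<bar> \<le> 2 * (\<Sum>j<count_list ks k. \<bar>b k j\<bar> * 2 ^ j)"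
      for k r
    have "\<exists>r. Q k r" if k: "k \<le> m" "k \<noteq> k0" for k
      unfolding Q_def
    proof (rule antiderivative_coeffs)
      have "nat \<bar>int k - int k0\<bar> dvd fact m"
        using k k0 by (intro dvd_fact) auto
      then have "int (nat \<bar>int k - int k0\<bar>) dvd int (fact m)"
        by (simp only: int_dvd_int_iff)
      then show "int k - int k0 dvd L" by (simp add: L_def)
    qed (use k count_le_length [of ks k] supp int in \<open>auto simp: s_def\<close>)
    then obtain r where "\<And>k. k \<le> m \<Longrightarrow> k \<noteq> k0 \<Longrightarrow> Q k (r k)"
      by metis
    then have r: "\<And>k j. k \<le> m \<Longrightarrow> k \<noteq> k0 \<Longrightarrow> of_int (int k - int k0) * r k j + r k (Suc j) = b k j"
      "\<And>k j. k \<le> m \<Longrightarrow> k \<noteq> k0 \<Longrightarrow> j \<ge> count_list ks k \<Longrightarrow> r k j = 0"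
      "\<And>k j. k \<le> m \<Longrightarrow> k \<noteq> k0 \<Longrightarrow> of_int L ^ (s - j) * r k j \<in> \<int>"
      "\<And>k. k \<le> m \<Longrightarrow> k \<noteq> k0 \<Longrightarrow> (\<Sum>j<count_list ks k. \<bar>r k j\<bar> * 2 ^ j) + \<bar>r k 0\<bar>
         \<le> 2 * (\<Sum>j<count_list ks k. \<bar>b k j\<bar> * 2 ^ j)"
      unfolding Q_def by blast+
    define K where "K = {..m} - {k0}"
    have KD: "k \<le> m" "k \<noteq> k0" if "k \<in> K" for k
      using that by (auto simp: K_def)
    have K': "finite K" "k0 \<notin> K" "{..m} = insert k0 K"
      using k0 by (auto simp: K_def)
    \<comment> \<open>At \<open>k0\<close> the constant is 0: integration is a shift, and the
      constant of integration makes the whole sum vanish at 0.\<close>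
    define b' where "b' k j = (if k = k0 then case j of 0 \<Rightarrow> - (\<Sum>k\<in>K. r k 0) | Suc i \<Rightarrow> b k0 i
      else if k \<le> m then r k j else 0)" for k j
    have b'k0: "b' k0 0 = - (\<Sum>k\<in>K. r k 0)" "b' k0 (Suc j) = b k0 j" for j
      by (auto simp: b'_def)
    have b'K: "b' k j = r k j" if "k \<in> K" for k j
      using KD [OF that] by (simp add: b'_def)
    have supp': "b' k j = 0" if "count_list (k0 # ks) k \<le> j" for k j
      using that supp [of k0] r(2) [of k] by (cases j) (auto simp: b'_def split: if_splits)
    have "of_int L ^ (s - j) * b' k j \<in> \<int>" for k j
    proof (cases "k = k0")
      case True
      show ?thesis
      proof (cases j)
        case 0
        have "of_int L ^ s * b' k0 0 = - (\<Sum>k\<in>K. of_int L ^ (s - 0) * r k 0)"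
          by (simp add: b'k0 sum_distrib_left)
        also have "\<dots> \<in> \<int>"
          using KD by (intro Ints_minus Ints_sum r(3)) auto
        finally show ?thesis using True 0 by simp
      next
        case (Suc i)
        then show ?thesis using int [of i k0] True by (simp add: b'k0)
      qed
    qed (use r(3) in \<open>auto simp: b'_def\<close>)
    moreover have "(\<Sum>k\<le>m. \<Sum>j<Suc s. \<bar>b' k j\<bar> * 2 ^ j) \<le> 2 ^ Suc s"
    proof -
      have trunc: "(\<Sum>j<count_list ks k. \<bar>b k j\<bar> * 2 ^ j) = (\<Sum>j<s. \<bar>b k j\<bar> * 2 ^ j)" for k
        using count_le_length [of ks k] by (intro sum.mono_neutral_left) (auto simp: s_def supp)
      \<comment> \<open>The summand \<open>\<bar>r k 0\<bar>\<close> is kept to pay for the constant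
        of integration at \<open>k0\<close>; the total size then at most doubles.\<close>
      have rk: "(\<Sum>j<Suc s. \<bar>b' k j\<bar> * 2 ^ j) + \<bar>r k 0\<bar> \<le> 2 * (\<Sum>j<s. \<bar>b k j\<bar> * 2 ^ j)" if k: "k \<in> K" for k
      proof -
        have "(\<Sum>j<Suc s. \<bar>b' k j\<bar> * 2 ^ j) = (\<Sum>j<count_list ks k. \<bar>r k j\<bar> * 2 ^ j)"
          unfolding b'K [OF k] using count_le_length [of ks k] KD [OF k]
          by (intro sum.mono_neutral_right) (auto simp: s_def r(2))
        then show ?thesis using r(4) [OF KD [OF k]] trunc [of k] by simp
      qed
      have "(\<Sum>j<Suc s. \<bar>b' k0 j\<bar> * 2 ^ j) = \<bar>\<Sum>k\<in>K. r k 0\<bar> + 2 * (\<Sum>j<s. \<bar>b k0 j\<bar> * 2 ^ j)"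
        unfolding sum.lessThan_Suc_shift by (simp add: b'k0 sum_distrib_left mult_ac)
      also have "\<dots> \<le> (\<Sum>k\<in>K. \<bar>r k 0\<bar>) + 2 * (\<Sum>j<s. \<bar>b k0 j\<bar> * 2 ^ j)"
        by (intro add_right_mono sum_abs)
      finally have "(\<Sum>k\<le>m. \<Sum>j<Suc s. \<bar>b' k j\<bar> * 2 ^ j) \<le>
          2 * (\<Sum>j<s. \<bar>b k0 j\<bar> * 2 ^ j) + (\<Sum>k\<in>K. (\<Sum>j<Suc s. \<bar>b' k j\<bar> * 2 ^ j) + \<bar>r k 0\<bar>)"
        using K' by (simp add: sum.distrib del: sum.lessThan_Suc)
      also have "\<dots> \<le> 2 * (\<Sum>j<s. \<bar>b k0 j\<bar> * 2 ^ j) + (\<Sum>k\<in>K. 2 * (\<Sum>j<s. \<bar>b k j\<bar> * 2 ^ j))"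
        by (intro add_left_mono sum_mono rk)
      also have "\<dots> = 2 * (\<Sum>k\<le>m. \<Sum>j<s. \<bar>b k j\<bar> * 2 ^ j)"
        using K' by (simp add: sum_distrib_left)
      finally show ?thesis using size by simp
    qed
    moreover have "0 < exp_poly m (Suc s) b' x \<and>
        exp_poly m (Suc s) b' x \<le> exp (real m * x) * (x ^ s / fact s)" if "x > 0" for x
    proof -
      have "(exp_poly m (Suc s) b' has_field_derivative
          real k0 * exp_poly m (Suc s) b' y + exp_poly m s b y) (at y)" for y
      proof (rule has_field_derivative_exp_poly)
        fix k j assume k: "k \<le> m"
        show "real k * b' k j + b' k (Suc j) = real k0 * b' k j + b k j"
        proof (cases "k = k0")
          case False
          then have "k \<in> K" using k by (simp add: K_def)
          then show ?thesis using r(1) [OF k False, of j] by (simp add: b'K algebra_simps)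
        qed (simp add: b'k0)
        show "b' k (Suc s) = 0"
          using count_le_length [of "k0 # ks" k] by (intro supp') (simp add: s_def)
      qed (simp add: supp_s)
      moreover have "exp_poly m (Suc s) b' 0 = 0"
        unfolding exp_poly_def sum.lessThan_Suc_shift using K' by (simp add: b'k0 b'K)
      ultimately have "0 < exp_poly m (Suc s) b' x \<and>
          exp_poly m (Suc s) b' x \<le> exp (real m * x) * (x ^ Suc (s - 1) / fact (Suc (s - 1)))"
        using bounds k0 that by (intro linear_ode_bounds) auto
      then show ?thesis using \<open>s \<ge> 1\<close> by simp
    qed
    ultimately show ?thesis
      using supp' by (intro exI [of _ b'] conjI) (auto simp: s_def L_def)
  qed
qed simp


section \<open>Transcendence of logarithms of rational numbers\<close>

lemma fact_power_le: "(fact r :: nat) ^ k \<le> fact (k * r)"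
proof (induction k)
  case (Suc k)
  have "(fact r :: nat) ^ Suc k \<le> fact r * fact (k * r)"
    using Suc by simp
  also have "\<dots> \<le> fact (Suc k * r)"
    using dvd_imp_le [OF fact_fact_dvd_fact [of r "k * r"]] by simp
  finally show ?case .
qed simp

lemma count_list_concat_replicate: "count_list (concat (replicate p xs)) x = p * count_list xs x"
  by (induction p) auto

lemma count_list_upt_le: "count_list [a..<b] x \<le> 1"
  by (induction b) auto

text \<open>The terms of the exponential series tend to 0.\<close>

lemma not_factorial_bounded:
  fixes D E :: real
  shows "\<exists>r. E * D ^ r < fact r"
proof -
  have "(\<lambda>r. E * (inverse (fact r) * D ^ r)) \<longlonglongrightarrow> E * 0"
    by (intro tendsto_mult tendsto_const summable_LIMSEQ_zero summable_exp)
  then have "\<forall>\<^sub>F r in sequentially. E * (inverse (fact r) * D ^ r) < 1"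
    by (intro order_tendstoD) auto
  then obtain r where "E * (inverse (fact r) * D ^ r) < 1"
    using eventually_happens trivial_limit_sequentially by blast
  then show ?thesis
    by (intro exI [of _ r]) (simp add: field_simps)
qed

text \<open>Hermite's form with each exponent from 0 to \<open>n\<close> used \<open>p\<close> times
  becomes, after scaling, an integer polynomial in \<alpha> with fewer than \<open>p + 1\<close>
  coefficients. In Liouville's bound the numerator collects \<open>n\<close> factors
  \<open>fact (p - 1)\<close>, while the remainder has at least \<open>n + 1\<close> of them in the
  denominator. The one left over beats every geometric factor.\<close>

lemma exp_algebraic_ne_quotient:
  fixes \<alpha> :: real and N M :: nat
  assumes alg: "algebraic \<alpha>" and \<alpha>: "\<alpha> > 0" and M: "M > 0"
  shows "exp \<alpha> \<noteq> N / M"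
proof
  assume q: "exp \<alpha> = N / M"
  obtain n :: nat and C :: real where n: "n \<ge> 1" and C: "C \<ge> 1" and
    liouville: "\<And>p t H. (\<And>j. j < p \<Longrightarrow> \<bar>t j\<bar> \<le> H) \<Longrightarrow> (\<Sum>j<p. of_int (t j) * \<alpha> ^ j) \<noteq> 0 \<Longrightarrow>
       1 \<le> C ^ (p + 1) * real_of_int H ^ (n - 1) * \<bar>\<Sum>j<p. of_int (t j) * \<alpha> ^ j\<bar>"
    using liouville_bound_poly [OF alg] by blast
  have "exp \<alpha> > 1" using \<alpha> by simp
  then have MN: "M \<le> N" using q M by (simp add: field_simps)
  define L where "L = (fact n :: real)"
  have L1: "L \<ge> 1" by (simp add: L_def)
  \<comment> \<open>\<open>D\<close> gathers the factors that occur to the power \<open>p\<close>;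
    \<open>E\<close> gathers the fixed ones and one more \<open>D\<close>, because
    \<open>p = r + 1\<close>.\<close>
  define D where "D = C * (2 * L) ^ (n * (n + 1)) * (1 + \<alpha>) ^ (n + 1)"
  define E where "E = C * real N ^ (n * n) * D"
  have "fact r \<le> E * D ^ r" for r
  proof -
    define p where "p = Suc r"
    define s where "s = p * Suc n"
    define ks where "ks = concat (replicate p [0..<Suc n])"
    have len: "length ks = s"
      by (simp add: ks_def s_def length_concat sum_list_replicate)
    have cnt: "count_list ks k \<le> p" for k
      using count_list_upt_le [of 0 "Suc n" k]
      by (simp add: ks_def count_list_concat_replicate del: upt_Suc)
    have sp: "p \<le> s" "s \<ge> 1" by (auto simp: s_def p_def)
    have "ks \<noteq> []" "set ks \<subseteq> {..n}"
      by (auto simp: ks_def p_def)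
    from hermite_pade_exp [OF this] obtain b where
      supp0: "\<And>k j. count_list ks k \<le> j \<Longrightarrow> b k j = 0" and
      int: "\<And>k j. of_int (fact n) ^ (s - 1 - j) * b k j \<in> \<int>" and
      size: "(\<Sum>k\<le>n. \<Sum>j<s. \<bar>b k j\<bar> * 2 ^ j) \<le> 2 ^ s" and
      R: "0 < exp_poly n s b \<alpha>" "exp_poly n s b \<alpha> \<le> exp (real n * \<alpha>) * (\<alpha> ^ (s - 1) / fact (s - 1))"
      unfolding len using \<alpha> by blast
    have supp: "b k j = 0" if "j \<ge> p" for k j
      using supp0 cnt [of k] that le_trans by blast
    \<comment> \<open>The quotient of factorials clears the denominators \<open>fact j\<close>,
      \<open>L ^ (s - 1)\<close> clears those of \<open>b\<close>, and the last factor is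
      \<open>M ^ n * exp (k * \<alpha>)\<close>.\<close>
    define T where "T j = (\<Sum>k\<le>n. (fact (p - 1) / fact j) * L ^ (s - 1) * b k j * (real N ^ k * real M ^ (n - k)))" for j
    define H where "H = (fact (p - 1) * fact n ^ s * 2 ^ s * int N ^ n :: int)"
    have H: "real_of_int H = fact (p - 1) * L ^ s * 2 ^ s * real N ^ n"
      by (simp add: H_def L_def)
    have T_int: "T j \<in> \<int>" if "j < p" for j
      unfolding T_def
    proof (rule Ints_sum)
      fix k assume "k \<in> {..n}"
      have "fact j dvd (fact (p - 1) :: nat)"
        using that by (intro fact_dvd) simp
      then obtain c :: nat where "(fact (p - 1) :: nat) = fact j * c" ..
      then have "(fact (p - 1) :: real) = fact j * real c"
        by (metis of_nat_fact of_nat_mult)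
      then have c: "fact (p - 1) / fact j = real c" by simp
      have "s - 1 = j + (s - 1 - j)" using that sp by simp
      then have "L ^ (s - 1) = L ^ j * L ^ (s - 1 - j)"
        by (metis power_add)
      then have "(fact (p - 1) / fact j) * L ^ (s - 1) * b k j * (real N ^ k * real M ^ (n - k)) =
          real_of_int (int c * fact n ^ j) * (of_int (fact n) ^ (s - 1 - j) * b k j) *
          real_of_int (int N ^ k * int M ^ (n - k))"
        unfolding c by (simp add: L_def mult_ac)
      also have "\<dots> \<in> \<int>"
        by (intro Ints_mult [OF Ints_mult [OF Ints_of_int int] Ints_of_int])
      finally show "(fact (p - 1) / fact j) * L ^ (s - 1) * b k j * (real N ^ k * real M ^ (n - k)) \<in> \<int>" .
    qed
    define t where "t j = \<lfloor>T j\<rfloor>" for j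
    have t: "of_int (t j) = T j" if "j < p" for j
      using T_int [OF that] unfolding t_def by (metis Ints_cases floor_of_int)
    have T_le: "\<bar>T j\<bar> \<le> real_of_int H" if "j < p" for j
    proof -
      have "\<bar>T j\<bar> \<le> (\<Sum>k\<le>n. \<bar>(fact (p - 1) / fact j) * L ^ (s - 1) * b k j * (real N ^ k * real M ^ (n - k))\<bar>)"
        unfolding T_def by (rule sum_abs)
      also have "\<dots> \<le> (\<Sum>k\<le>n. fact (p - 1) * L ^ s * (\<Sum>j<s. \<bar>b k j\<bar> * 2 ^ j) * real N ^ n)"
      proof (rule sum_mono)
        fix k assume "k \<in> {..n}"
        then have "real N ^ n = real N ^ k * real N ^ (n - k)"
          by (simp flip: power_add)
        then have "real N ^ k * real M ^ (n - k) \<le> real N ^ n"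
          using MN by (auto intro!: mult_left_mono power_mono)
        moreover have "\<bar>b k j\<bar> \<le> (\<Sum>j<s. \<bar>b k j\<bar> * 2 ^ j)"
        proof -
          have "\<bar>b k j\<bar> \<le> \<bar>b k j\<bar> * 2 ^ j"
            by (simp add: mult_le_cancel_left1)
          also have "\<dots> \<le> (\<Sum>j<s. \<bar>b k j\<bar> * 2 ^ j)"
            using that sp by (intro member_le_sum) auto
          finally show ?thesis .
        qed
        moreover have "L ^ (s - 1) \<le> L ^ s"
          using L1 by (intro power_increasing) auto
        moreover have "(fact (p - 1) / fact j :: real) \<le> fact (p - 1)"
          by (simp add: divide_le_eq mult_le_cancel_left1 fact_ge_1)
        ultimately have "(fact (p - 1) / fact j) * L ^ (s - 1) * \<bar>b k j\<bar> * (real N ^ k * real M ^ (n - k))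
            \<le> fact (p - 1) * L ^ s * (\<Sum>j<s. \<bar>b k j\<bar> * 2 ^ j) * real N ^ n"
          using L1 by (intro mult_mono mult_nonneg_nonneg sum_nonneg) auto
        then show "\<bar>(fact (p - 1) / fact j) * L ^ (s - 1) * b k j * (real N ^ k * real M ^ (n - k))\<bar>
            \<le> fact (p - 1) * L ^ s * (\<Sum>j<s. \<bar>b k j\<bar> * 2 ^ j) * real N ^ n"
          using L1 by (simp add: abs_mult)
      qed
      also have "\<dots> = fact (p - 1) * L ^ s * real N ^ n * (\<Sum>k\<le>n. \<Sum>j<s. \<bar>b k j\<bar> * 2 ^ j)"
        unfolding sum_distrib_left by (simp only: sum_distrib_left sum_distrib_right mult_ac)
      also have "\<dots> \<le> fact (p - 1) * L ^ s * real N ^ n * 2 ^ s"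
        using L1 by (intro mult_left_mono size) auto
      finally show ?thesis by (simp add: H mult_ac)
    qed
    have sum_eq: "(\<Sum>j<p. of_int (t j) * \<alpha> ^ j) = fact (p - 1) * L ^ (s - 1) * real M ^ n * exp_poly n s b \<alpha>"
    proof -
      have "(\<Sum>j<p. of_int (t j) * \<alpha> ^ j) = (\<Sum>j<p. T j * \<alpha> ^ j)"
        by (intro sum.cong) (auto simp: t)
      also have "\<dots> = (\<Sum>k\<le>n. \<Sum>j<p. (fact (p - 1) / fact j) * L ^ (s - 1) * b k j * (real N ^ k * real M ^ (n - k)) * \<alpha> ^ j)"
        unfolding T_def sum_distrib_right by (rule sum.swap)
      also have "\<dots> = (\<Sum>k\<le>n. fact (p - 1) * L ^ (s - 1) * real M ^ n *
          (exp (real k * \<alpha>) * (\<Sum>j<s. b k j * (\<alpha> ^ j / fact j))))"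
      proof (rule sum.cong [OF refl])
        fix k assume k: "k \<in> {..n}"
        have "(\<Sum>j<s. b k j * (\<alpha> ^ j / fact j)) = (\<Sum>j<p. b k j * (\<alpha> ^ j / fact j))"
          using sp by (intro sum.mono_neutral_right) (auto simp: supp)
        moreover have "real M ^ n * exp (real k * \<alpha>) = real N ^ k * real M ^ (n - k)"
        proof -
          have "real M ^ n = real M ^ k * real M ^ (n - k)"
            using k by (simp flip: power_add)
          then show ?thesis
            using M by (simp add: exp_of_nat_mult q power_divide)
        qed
        ultimately have "fact (p - 1) * L ^ (s - 1) * real M ^ n *
          (exp (real k * \<alpha>) * (\<Sum>j<s. b k j * (\<alpha> ^ j / fact j))) =
          fact (p - 1) * L ^ (s - 1) * (real N ^ k * real M ^ (n - k)) * (\<Sum>j<p. b k j * (\<alpha> ^ j / fact j))"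
          by (simp only: mult.assoc [symmetric]) (simp only: mult.assoc)
        then show "(\<Sum>j<p. (fact (p - 1) / fact j) * L ^ (s - 1) * b k j * (real N ^ k * real M ^ (n - k)) * \<alpha> ^ j) =
            fact (p - 1) * L ^ (s - 1) * real M ^ n *
            (exp (real k * \<alpha>) * (\<Sum>j<s. b k j * (\<alpha> ^ j / fact j)))"
          by (simp add: sum_distrib_left mult_ac)
      qed
      also have "\<dots> = fact (p - 1) * L ^ (s - 1) * real M ^ n * exp_poly n s b \<alpha>"
        by (simp only: exp_poly_def sum_distrib_left)
      finally show ?thesis .
    qed
    have pos: "(\<Sum>j<p. of_int (t j) * \<alpha> ^ j) > 0"
      unfolding sum_eq using R(1) L1 M by simp
    have "1 \<le> C ^ (p + 1) * real_of_int H ^ (n - 1) * \<bar>\<Sum>j<p. of_int (t j) * \<alpha> ^ j\<bar>"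
    proof (rule liouville)
      fix j assume "j < p"
      then have "real_of_int \<bar>t j\<bar> \<le> real_of_int H"
        using T_le t by simp
      then show "\<bar>t j\<bar> \<le> H" by (simp only: of_int_le_iff)
    qed (use pos in simp)
    also have "\<dots> \<le> C ^ (p + 1) * real_of_int H ^ (n - 1) * (real_of_int H * (1 + \<alpha>) ^ s / fact (p - 1) ^ Suc n)"
    proof (rule mult_left_mono)
      have "\<bar>\<Sum>j<p. of_int (t j) * \<alpha> ^ j\<bar> = fact (p - 1) * L ^ (s - 1) * real M ^ n * exp_poly n s b \<alpha>"
        using pos sum_eq by simp
      also have "\<dots> \<le> fact (p - 1) * L ^ (s - 1) * real M ^ n * (exp (real n * \<alpha>) * (\<alpha> ^ (s - 1) / fact (s - 1)))"
        using L1 by (intro mult_left_mono R(2)) auto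
      also have "\<dots> = fact (p - 1) * L ^ (s - 1) * real N ^ n * (\<alpha> ^ (s - 1) / fact (s - 1))"
        using M by (simp add: exp_of_nat_mult q power_divide)
      also have "\<dots> \<le> fact (p - 1) * (L ^ s * 2 ^ s) * real N ^ n * ((1 + \<alpha>) ^ s / fact (p - 1) ^ Suc n)"
      proof (intro mult_mono frac_le)
        have "L ^ (s - 1) \<le> L ^ s" using L1 by (intro power_increasing) auto
        also have "L ^ s \<le> L ^ s * 2 ^ s" using L1 by (simp add: mult_le_cancel_left1)
        finally show "L ^ (s - 1) \<le> L ^ s * 2 ^ s" .
        \<comment> \<open>The base \<open>1 + \<alpha>\<close> allows the exponent to be raised even
          when \<open>\<alpha> < 1\<close>.\<close>
        have "\<alpha> ^ (s - 1) \<le> (1 + \<alpha>) ^ (s - 1)" using \<alpha> by (intro power_mono) auto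
        also have "\<dots> \<le> (1 + \<alpha>) ^ s" using \<alpha> by (intro power_increasing) auto
        finally show "\<alpha> ^ (s - 1) \<le> (1 + \<alpha>) ^ s" .
        have "(fact (p - 1) :: nat) ^ Suc n \<le> fact (Suc n * (p - 1))"
          by (rule fact_power_le)
        also have "\<dots> \<le> fact (s - 1)"
          by (intro fact_mono) (auto simp: s_def p_def)
        finally show "(fact (p - 1) :: real) ^ Suc n \<le> fact (s - 1)"
          by (metis of_nat_fact of_nat_le_iff of_nat_power)
      qed (use L1 \<alpha> in auto)
      finally show "\<bar>\<Sum>j<p. of_int (t j) * \<alpha> ^ j\<bar> \<le> real_of_int H * (1 + \<alpha>) ^ s / fact (p - 1) ^ Suc n"
        by (simp add: H mult_ac)
    qed (use C in \<open>auto simp: H_def\<close>)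
    also have "\<dots> = C ^ (p + 1) * real_of_int H ^ Suc (n - 1) * (1 + \<alpha>) ^ s / fact (p - 1) ^ Suc n"
      by simp
    also have "Suc (n - 1) = n" using n by simp
    \<comment> \<open>\<open>H ^ n\<close> supplies \<open>n\<close> factors
      \<open>fact (p - 1)\<close> and leaves exactly one in the denominator.\<close>
    also have "C ^ (p + 1) * real_of_int H ^ n * (1 + \<alpha>) ^ s / fact (p - 1) ^ Suc n =
        C ^ (p + 1) * (L ^ s * 2 ^ s * real N ^ n) ^ n * (1 + \<alpha>) ^ s / fact (p - 1)"
      by (simp add: H power_mult_distrib)
    also have "(L ^ s * 2 ^ s * real N ^ n) ^ n = ((2 * L) ^ (n * (n + 1))) ^ p * real N ^ (n * n)"
      by (simp add: s_def power_mult_distrib flip: power_mult) (simp add: algebra_simps)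
    also have "(1 + \<alpha>) ^ s = ((1 + \<alpha>) ^ (n + 1)) ^ p"
      by (simp only: s_def power_mult [symmetric] Suc_eq_plus1 mult.commute)
    also have "C ^ (p + 1) * (((2 * L) ^ (n * (n + 1))) ^ p * real N ^ (n * n)) * ((1 + \<alpha>) ^ (n + 1)) ^ p
        = C * real N ^ (n * n) * D ^ p"
      by (simp only: D_def power_mult_distrib power_add power_one_right mult_ac)
    also have "\<dots> = E * D ^ r"
      by (simp add: E_def p_def)
    finally have "1 \<le> E * D ^ r / fact r" by (simp add: p_def)
    then show "fact r \<le> E * D ^ r" by (simp add: field_simps)
  qed
  moreover obtain r where "E * D ^ r < fact r"
    using not_factorial_bounded by blast
  ultimately show False by (meson not_le)
qed

lemma ln_quotient_transcendental:
  fixes N M :: nat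
  assumes "N > 0" "M > 0" "N \<noteq> M"
  shows "\<not> algebraic (ln (real N) - ln (real M))"
proof
  assume alg: "algebraic (ln (real N) - ln (real M))"
  show False
  proof (cases "M < N")
    case True
    then show False
      using exp_algebraic_ne_quotient [OF alg _ \<open>M > 0\<close>, of N] assms by (simp add: exp_diff)
  next
    case False
    have "algebraic (ln (real M) - ln (real N))"
      using algebraic_minus [OF alg] by simp
    from exp_algebraic_ne_quotient [OF this _ \<open>N > 0\<close>, of M] False assms
    show False by (simp add: exp_diff)
  qed
qed


section \<open>The theorem\<close>

theorem theorem2:
  fixes \<kappa> :: "'n::finite \<Rightarrow> complex" and s0 :: complex
  assumes "0 < Re s0" and "Re s0 < 1"
  shows "(\<exists>\<^sub>\<le>\<^sub>1 x. x \<in> {log_deriv_sum N f s0 |N f.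
                      N \<ge> 1 \<and> f \<in> E_forms \<kappa> N s0 \<and> L_function N f (1 - s0) \<noteq> 0} \<and> algebraic x) \<and>
         (s0 \<in> \<real> \<and>
          (\<forall>j. \<kappa> j \<in> \<real> \<and> Re (s0 + \<kappa> j) \<ge> 1 \<and> Re (1 - s0 + \<kappa> j) \<ge> 1) \<longrightarrow>
          (\<forall>N::nat. N \<ge> 1 \<and> real N powr (1 / real CARD('n)) > 4 * pi * exp euler_mascheroni \<longrightarrow>
             (\<forall>f \<in> E_forms \<kappa> N s0. L_function N f (1 - s0) \<noteq> 0 \<longrightarrow> log_deriv_sum N f s0 \<noteq> 0)))"
proof (intro conjI impI allI ballI)
  show "\<exists>\<^sub>\<le>\<^sub>1 x. x \<in> {log_deriv_sum N f s0 |N f.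
      N \<ge> 1 \<and> f \<in> E_forms \<kappa> N s0 \<and> L_function N f (1 - s0) \<noteq> 0} \<and> algebraic x"
  proof (rule Uniq_I)
    fix x y
    assume "x \<in> {log_deriv_sum N f s0 |N f.
        N \<ge> 1 \<and> f \<in> E_forms \<kappa> N s0 \<and> L_function N f (1 - s0) \<noteq> 0} \<and> algebraic x"
    then obtain N where N: "N \<ge> 1" "x = log_deriv_const \<kappa> s0 - of_real (ln (real N))" and x: "algebraic x"
      using log_deriv_sum_eq [OF assms] by blast
    assume "y \<in> {log_deriv_sum N f s0 |N f.
        N \<ge> 1 \<and> f \<in> E_forms \<kappa> N s0 \<and> L_function N f (1 - s0) \<noteq> 0} \<and> algebraic y"
    then obtain M where M: "M \<ge> 1" "y = log_deriv_const \<kappa> s0 - of_real (ln (real M))" and y: "algebraic y"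
      using log_deriv_sum_eq [OF assms] by blast
    \<comment> \<open>The constant \<open>log_deriv_const \<kappa> s0\<close> cancels; only the
      conductors remain.\<close>
    have "y - x = of_real (ln (real N) - ln (real M))"
      by (simp add: N M)
    then have "algebraic (ln (real N) - ln (real M))"
      using algebraic_diff [OF y x] by (simp only: algebraic_of_real_iff)
    then have "N = M"
      using ln_quotient_transcendental [of N M] N(1) M(1) by fastforce
    \<comment> \<open>The values depend on the form through its conductor only.\<close>
    then show "x = y"
      by (simp add: N M)
  qed
next
  fix N :: nat and f :: "'n level_fun"
  let ?c = "4 * pi * exp euler_mascheroni :: real"
  assume "s0 \<in> \<real> \<and> (\<forall>j. \<kappa> j \<in> \<real> \<and> Re (s0 + \<kappa> j) \<ge> 1 \<and> Re (1 - s0 + \<kappa> j) \<ge> 1)"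
  then have c: "Re (log_deriv_const \<kappa> s0) \<le> real CARD('n) * ln ?c"
    by (intro log_deriv_const_real) auto
  assume N: "N \<ge> 1 \<and> real N powr (1 / real CARD('n)) > ?c"
  then have "ln ?c < ln (real N powr (1 / real CARD('n)))"
    by (subst ln_less_cancel_iff) auto
  then have "real CARD('n) * ln ?c < ln (real N)"
    using N by (simp add: ln_powr field_simps)
  moreover assume "f \<in> E_forms \<kappa> N s0" and "L_function N f (1 - s0) \<noteq> 0"
  then have "log_deriv_sum N f s0 = log_deriv_const \<kappa> s0 - of_real (ln (real N))"
    using N by (intro log_deriv_sum_eq [OF assms]) auto
  \<comment> \<open>A negative real part is enough for the complex value to be nonzero.\<close>
  ultimately have "Re (log_deriv_sum N f s0) < 0"
    using c by simp
  then show "log_deriv_sum N f s0 \<noteq> 0"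
    by auto
qed

end
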